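(* Let $(e_i)$ be a $1$-subsymmetric basis for a Banach space $X$. Suppose that there exists a unit vector $x\in X$ such that $(e_i)$ does not dominate the sequence $(x^i)_{i=1}^\infty\subseteq X(\omega^2)$. Then $(e_i)$ admits a continuum of (pairwise) non-equivalent subsymmetric block bases.
   Context: Basic sequences $(x_j)$ and $(y_j)$ are equivalent if, for all scalars $(a_j)$, $\sum_j a_jx_j$ converges if and only if $\sum_j a_jy_j$ converges. A basic sequence is subsymmetric if it is unconditional and equivalent to each of its subsequences; it is $1$-subsymmetric if it is $1$-unconditional and isometrically equivalent to each of its subsequences. A basic sequence $(x_n)$ dominates a basic sequence $(y_n)$ if there is a bounded linear operator from the closed linear span of $(x_n)$ to that of $(y_n)$ mapping $x_n$ to $y_n$ for all $n$. A block basis with respect to a basic sequence $(x_n)$ is a sequence $(y_n)$ of non-zero vectors $y_n=\sum_{k=p_n+1}^{p_{n+1}}a_kx_k$ with $p_1<p_2<\cdots$ natural numbers. For a Banach space $X$ with $1$-subsymmetric basis $(e_i)_{i=1}^\infty$, $X(\omega^2)$ is the completion of the vector space with basis $\{e_\alpha:\alpha<\omega^2\}$ (indexed by ordinals) under the norm $\|\sum_{i=1}^n a_ie_{\alpha_i}\|=\|\sum_{i=1}^n a_ie_i\|_X$ for $0\le\alpha_1<\alpha_2<\dots<\alpha_n<\omega^2$. For $0\ne x=\sum_{j=1}^\infty a_je_j\in X$ and $i\ge1$, $x^i=\sum_{j=1}^\infty a_je_{\omega(i-1)+j}\in X(\omega^2)$. "A continuum" means a family of cardinality $2^{\aleph_0}$.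 *)

theory Defs
  imports "HOL-Analysis.Analysis" "HOL-Library.Equipollence"
begin

text \<open>
  Scalars: a type \<open>'k\<close> of sort \<open>{real_normed_field, banach}\<close> is, by the Gelfand-Mazur theorem,
  isometrically isomorphic to the reals or to the complex numbers, so a Banach space over
  \<open>'k\<close> is a real or a complex Banach space.  It is given by a type of class \<open>banach\<close>
  (which provides the additive structure, the norm and completeness) together with a scalar
  multiplication \<open>s :: 'k \<Rightarrow> 'a \<Rightarrow> 'a\<close> compatible with it.
\<close>

definition normed_scaling :: "('k::real_normed_field \<Rightarrow> 'a::real_normed_vector \<Rightarrow> 'a) \<Rightarrow> bool" where
  "normed_scaling s \<longleftrightarrow> vector_space s
     \<and> (\<forall>c x. norm (s c x) = norm c * norm x)
     \<and> (\<forall>r x. s (of_real r) x = r *\<^sub>R x)"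

lemma normed_scaling_scaleR: "normed_scaling (scaleR :: real \<Rightarrow> 'a::real_normed_vector \<Rightarrow> 'a)"
  by (simp add: normed_scaling_def real_vector.vector_space_axioms)

lemma normed_scaling_mult: "normed_scaling ((*) :: 'k::real_normed_field \<Rightarrow> 'k \<Rightarrow> 'k)"
  by (simp add: normed_scaling_def vector_space_over_itself.vector_space_axioms norm_mult
      scaleR_conv_of_real)

definition closed_span ::
  "('k::real_normed_field \<Rightarrow> 'a::real_normed_vector \<Rightarrow> 'a) \<Rightarrow> 'a set \<Rightarrow> 'a set" where
  "closed_span s A = closure (module.span s A)"

definition schauder_basis_of ::
  "('k::real_normed_field \<Rightarrow> 'a::real_normed_vector \<Rightarrow> 'a) \<Rightarrow> (nat \<Rightarrow> 'a) \<Rightarrow> 'a set \<Rightarrow> bool" where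
  "schauder_basis_of s e V \<longleftrightarrow>
     range e \<subseteq> V \<and> (\<forall>x\<in>V. \<exists>!a. (\<lambda>j. s (a j) (e j)) sums x)"

definition basis_coeff ::
  "('k::real_normed_field \<Rightarrow> 'a::real_normed_vector \<Rightarrow> 'a) \<Rightarrow> (nat \<Rightarrow> 'a) \<Rightarrow> 'a \<Rightarrow> nat \<Rightarrow> 'k" where
  "basis_coeff s e x = (THE a. (\<lambda>j. s (a j) (e j)) sums x)"

definition basic_sequence ::
  "('k::real_normed_field \<Rightarrow> 'a::real_normed_vector \<Rightarrow> 'a) \<Rightarrow> (nat \<Rightarrow> 'a) \<Rightarrow> bool" where
  "basic_sequence s x \<longleftrightarrow> schauder_basis_of s x (closed_span s (range x))"

definition equivalent_sequences ::
  "('k::real_normed_field \<Rightarrow> 'a::real_normed_vector \<Rightarrow> 'a) \<Rightarrow> (nat \<Rightarrow> 'a) \<Rightarrow> (nat \<Rightarrow> 'a) \<Rightarrow> bool" where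
  "equivalent_sequences s x y \<longleftrightarrow>
     (\<forall>a. summable (\<lambda>j. s (a j) (x j)) \<longleftrightarrow> summable (\<lambda>j. s (a j) (y j)))"

definition isometrically_equivalent ::
  "('k::real_normed_field \<Rightarrow> 'a::real_normed_vector \<Rightarrow> 'a) \<Rightarrow> (nat \<Rightarrow> 'a) \<Rightarrow> (nat \<Rightarrow> 'a) \<Rightarrow> bool" where
  "isometrically_equivalent s x y \<longleftrightarrow>
     (\<forall>n a. norm (\<Sum>j<n. s (a j) (x j)) = norm (\<Sum>j<n. s (a j) (y j)))"

definition unconditional ::
  "('k::real_normed_field \<Rightarrow> 'a::real_normed_vector \<Rightarrow> 'a) \<Rightarrow> (nat \<Rightarrow> 'a) \<Rightarrow> bool" where
  "unconditional s x \<longleftrightarrow> basic_sequence s x \<and>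
     (\<forall>a. summable (\<lambda>j. s (a j) (x j)) \<longrightarrow>
        (\<forall>\<pi>. bij \<pi> \<longrightarrow> summable (\<lambda>j. s (a (\<pi> j)) (x (\<pi> j)))))"

definition subsymmetric ::
  "('k::real_normed_field \<Rightarrow> 'a::real_normed_vector \<Rightarrow> 'a) \<Rightarrow> (nat \<Rightarrow> 'a) \<Rightarrow> bool" where
  "subsymmetric s x \<longleftrightarrow> unconditional s x \<and>
     (\<forall>r. strict_mono r \<longrightarrow> equivalent_sequences s x (x \<circ> r))"

text \<open>
  Invariance is required for the signs 1 and -1 only.  Over the complex numbers this is weaker
  than invariance under all unimodular multipliers.
\<close>

definition one_unconditional ::
  "('k::real_normed_field \<Rightarrow> 'a::real_normed_vector \<Rightarrow> 'a) \<Rightarrow> (nat \<Rightarrow> 'a) \<Rightarrow> bool" where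
  "one_unconditional s x \<longleftrightarrow> basic_sequence s x \<and>
     (\<forall>n a \<epsilon>. (\<forall>j. \<epsilon> j = 1 \<or> \<epsilon> j = -1) \<longrightarrow>
        norm (\<Sum>j<n. s (\<epsilon> j * a j) (x j)) = norm (\<Sum>j<n. s (a j) (x j)))"

definition one_subsymmetric ::
  "('k::real_normed_field \<Rightarrow> 'a::real_normed_vector \<Rightarrow> 'a) \<Rightarrow> (nat \<Rightarrow> 'a) \<Rightarrow> bool" where
  "one_subsymmetric s x \<longleftrightarrow> one_unconditional s x \<and>
     (\<forall>r. strict_mono r \<longrightarrow> isometrically_equivalent s x (x \<circ> r))"

text \<open>
  The operator is only constrained on the closed linear span of \<open>x\<close>; its values elsewhere are
  irrelevant.
\<close>

definition dominates ::
  "('k::real_normed_field \<Rightarrow> 'a::real_normed_vector \<Rightarrow> 'a) \<Rightarrow> ('k \<Rightarrow> 'b::real_normed_vector \<Rightarrow> 'b)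
     \<Rightarrow> (nat \<Rightarrow> 'a) \<Rightarrow> (nat \<Rightarrow> 'b) \<Rightarrow> bool" where
  "dominates s t x y \<longleftrightarrow>
     (\<exists>T. T ` closed_span s (range x) \<subseteq> closed_span t (range y)
        \<and> (\<forall>u\<in>closed_span s (range x). \<forall>v\<in>closed_span s (range x). T (u + v) = T u + T v)
        \<and> (\<forall>c. \<forall>u\<in>closed_span s (range x). T (s c u) = t c (T u))
        \<and> (\<exists>K. \<forall>u\<in>closed_span s (range x). norm (T u) \<le> K * norm u)
        \<and> (\<forall>n. T (x n) = y n))"

text \<open>Sequences are indexed from 0, so the block from \<open>p_n + 1\<close> to \<open>p_{n+1}\<close> becomes
  \<open>{p n..<p (Suc n)}\<close>.\<close>

definition block_basis ::
  "('k::real_normed_field \<Rightarrow> 'a::real_normed_vector \<Rightarrow> 'a) \<Rightarrow> (nat \<Rightarrow> 'a) \<Rightarrow> (nat \<Rightarrow> 'a) \<Rightarrow> bool" where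
  "block_basis s x y \<longleftrightarrow>
     (\<exists>p a. strict_mono p \<and> (\<forall>n. y n = (\<Sum>k\<in>{p n..<p (Suc n)}. s (a k) (x k)) \<and> y n \<noteq> 0))"

text \<open>
  An ordinal below \<open>\<omega>\<^sup>2\<close> is written uniquely as \<open>\<omega> \<cdot> i + j\<close> with \<open>i, j < \<omega>\<close> and is encoded as
  the pair \<open>(i, j)\<close>; the order of the ordinals is then the lexicographic one.
\<close>

definition omega_sq_less :: "nat \<times> nat \<Rightarrow> nat \<times> nat \<Rightarrow> bool" where
  "omega_sq_less \<alpha> \<beta> \<longleftrightarrow> (\<alpha>, \<beta>) \<in> less_than <*lex*> less_than"

text \<open>
  The closed linear span of \<open>E\<close> in the Banach space \<open>'b\<close> (with scalar multiplication \<open>t\<close>) is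
  the completion \<open>X(\<omega>\<^sup>2)\<close>, and \<open>E (i, j)\<close> is its basis vector indexed by \<open>\<omega> \<cdot> i + j\<close>.  Indeed, the
  norm condition says that \<open>e\<^sub>\<alpha> \<mapsto> E \<alpha>\<close> extends to a linear isometry of the normed space to be
  completed onto the linear span of \<open>E\<close>, and a closed subspace of a Banach space is complete.
  The ambient space may be larger than this span, so that a realisation exists in a fixed type
  for every \<open>e\<close>: \<open>X(\<omega>\<^sup>2)\<close> is separable and embeds isometrically into the space of bounded
  sequences of scalars.
\<close>

definition omega_sq_realisation ::
  "('k::real_normed_field \<Rightarrow> 'a::real_normed_vector \<Rightarrow> 'a) \<Rightarrow> (nat \<Rightarrow> 'a)
     \<Rightarrow> ('k \<Rightarrow> 'b::banach \<Rightarrow> 'b) \<Rightarrow> (nat \<times> nat \<Rightarrow> 'b) \<Rightarrow> bool" where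
  "omega_sq_realisation s e t E \<longleftrightarrow>
     normed_scaling t
     \<and> (\<forall>n a \<alpha>. (\<forall>i k. i < k \<and> k < n \<longrightarrow> omega_sq_less (\<alpha> i) (\<alpha> k)) \<longrightarrow>
          norm (\<Sum>i<n. t (a i) (E (\<alpha> i))) = norm (\<Sum>i<n. s (a i) (e i)))"

text \<open>
  The vectors \<open>x\<^sup>i = \<Sum>\<^sub>j a\<^sub>j e\<^bsub>\<omega>(i-1)+j\<^esub>\<close>.  In that formula \<open>i\<close> and \<open>j\<close> start from 1, here they
  start from 0; hence \<open>i\<close> in place of \<open>i - 1\<close> and \<open>Suc j\<close> in place of \<open>j\<close> in the index of \<open>E\<close>.
\<close>

definition omega_copy ::
  "('k::real_normed_field \<Rightarrow> 'a::real_normed_vector \<Rightarrow> 'a) \<Rightarrow> (nat \<Rightarrow> 'a)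
     \<Rightarrow> ('k \<Rightarrow> 'b::banach \<Rightarrow> 'b) \<Rightarrow> (nat \<times> nat \<Rightarrow> 'b) \<Rightarrow> 'a \<Rightarrow> nat \<Rightarrow> 'b" where
  "omega_copy s e t E x i = (\<Sum>j. t (basis_coeff s e x j) (E (i, Suc j)))"

end

theory Submission imports Defs begin

text \<open>
  Let \<open>a\<close> be the coefficients of \<open>x\<close> and let \<open>P\<^sub>N x\<close> be its truncation to the first \<open>N\<close>
  coordinates.  If \<open>(e\<^sub>i)\<close> does not dominate \<open>(x\<^sup>i)\<close>, then for every \<open>M\<close> there are arbitrarily
  large \<open>N\<close> and a finite scalar sequence \<open>b\<close> such that the combination with coefficients \<open>b\<close> of
  consecutive copies of \<open>P\<^sub>N x\<close> has more than \<open>M\<close> times the norm of \<open>\<Sum>b\<^sub>i e\<^sub>i\<close>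
  (\<open>dominates_omega_copy\<close>).  On the other hand, for each fixed \<open>N\<close> the ratio of these norms is
  bounded.  These two facts allow an inductive choice (\<open>block_tower_exists\<close>) of weights \<open>c\<^sub>k\<close>,
  lengths \<open>N\<^sub>k\<close> and witnesses \<open>b\<^sup>k\<close> such that, for any set \<open>A\<close> of natural numbers, the witness
  \<open>b\<^sup>k\<close> has norm at least 1 against consecutive copies of \<open>z\<^sub>A = \<Sum>k\<in>A. c\<^sub>k P\<^bsub>N\<^sub>k\<^esub> x\<close> if
  \<open>k \<in> A\<close>, but norm at most \<open>2/2\<^sup>k\<close> if \<open>k \<notin> A\<close> (\<open>witness_block_ge\<close>, \<open>witness_block_le\<close>): the
  earlier truncations do not notice \<open>b\<^sup>k\<close> because its norm against \<open>e\<close> is tiny, the later ones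
  because their weights are.

  Concatenating the witnesses for \<open>k \<in> A - B\<close> shows that the sequences belonging to \<open>A\<close> and \<open>B\<close>
  are not equivalent if \<open>A - B\<close> is infinite (\<open>not_equivalent_blocks\<close>), and there is a continuum of
  sets with pairwise infinite differences (\<open>almost_disjoint_family\<close>).

  The copies of \<open>z\<^sub>A\<close> live in \<open>X(\<omega>\<^sup>2)\<close>.  To obtain a block basis of \<open>e\<close> itself, the \<open>i\<close>-th copy
  is restricted to the terms with \<open>k \<le> i\<close>, which has finite support and changes the copy by at
  most \<open>\<Sum>k>i. c\<^sub>k \<le> 1/2\<^sup>i\<close>.  Such a summable error does not affect convergence, so the block
  basis is subsymmetric because consecutive copies of a fixed vector are (\<open>subsymmetric_block\<close>).
\<close>

section \<open>Normed spaces over an abstract scalar field\<close>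

locale normed_scaling_space =
  fixes s :: "'k::real_normed_field \<Rightarrow> 'a::real_normed_vector \<Rightarrow> 'a"
  assumes normed_scaling: "normed_scaling s"
begin

sublocale vector_space s
  using normed_scaling by (simp add: normed_scaling_def)

lemma norm_s: "norm (s c v) = norm c * norm v"
  using normed_scaling by (simp add: normed_scaling_def)

lemma s_of_real: "s (of_real r) v = r *\<^sub>R v"
  using normed_scaling by (simp add: normed_scaling_def)

lemma s_of_real_mult: "s (of_real r * c) v = r *\<^sub>R s c v"
  by (metis s_of_real scale_scale)

lemma s_scaleR: "s c (r *\<^sub>R v) = r *\<^sub>R s c v"
  by (metis s_of_real scale_left_commute)

lemma bounded_linear_s: "bounded_linear (s c)"
  by (rule bounded_linear_intro[where K = "norm c"])
    (simp_all add: scale_right_distrib s_scaleR norm_s mult.commute)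

lemma tendsto_s:
  assumes "(f \<longlongrightarrow> c) F" shows "((\<lambda>q. s (f q) v) \<longlongrightarrow> s c v) F"
proof -
  have "((\<lambda>q. norm (f q - c) * norm v) \<longlongrightarrow> 0) F"
    using tendsto_mult_left_zero[OF tendsto_norm_zero[OF LIM_zero[OF assms]]] by simp
  moreover have "norm (s (f q) v - s c v) = norm (f q - c) * norm v" for q
    by (metis norm_s scale_left_diff_distrib)
  ultimately have "((\<lambda>q. norm (s (f q) v - s c v)) \<longlongrightarrow> 0) F" by simp
  then show ?thesis by (rule LIM_zero_cancel[OF tendsto_norm_zero_cancel])
qed

lemma in_span_range_iff:
  fixes y :: "nat \<Rightarrow> 'a"
  shows "z \<in> span (range y) \<longleftrightarrow> (\<exists>n b. z = (\<Sum>i<n. s (b i) (y i)))"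
proof
  assume "z \<in> span (range y)"
  then show "\<exists>n b. z = (\<Sum>i<n. s (b i) (y i))"
  proof (induction rule: span_induct_alt)
    case base
    show ?case by (rule exI[of _ "0::nat"]) simp
  next
    case (step c v z)
    then obtain i n b where v: "v = y i" and z: "z = (\<Sum>i<n. s (b i) (y i))" by auto
    let ?m = "max n (Suc i)"
    have "z = (\<Sum>i<?m. s (if i < n then b i else 0) (y i))"
      unfolding z by (rule sum.mono_neutral_cong_left) auto
    moreover have "s c v = (\<Sum>i'<?m. s (if i' = i then c else 0) (y i'))"
      unfolding v by (subst sum.remove[of _ i]) (auto intro!: sum.neutral)
    ultimately have "s c v + z
        = (\<Sum>i'<?m. s ((if i' = i then c else 0) + (if i' < n then b i' else 0)) (y i'))"
      by (simp add: scale_left_distrib sum.distrib)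
    then show ?case
      by (intro exI[of _ ?m] exI[of _ "\<lambda>i'. (if i' = i then c else 0) + (if i' < n then b i' else 0)"])
  qed
next
  assume "\<exists>n b. z = (\<Sum>i<n. s (b i) (y i))"
  then obtain n b where "z = (\<Sum>i<n. s (b i) (y i))" by blast
  then show "z \<in> span (range y)"
    by (simp add: span_sum span_scale span_base)
qed

lemma range_subset_closed_span: "range y \<subseteq> closed_span s (range y)"
  unfolding closed_span_def by (rule order.trans[OF span_superset closure_subset])

lemma sums_in_closed_span:
  assumes "(\<lambda>i. s (b i) (y i)) sums z" shows "z \<in> closed_span s (range y)"
proof -
  have "(\<Sum>i<n. s (b i) (y i)) \<in> span (range y)" for n
    by (intro span_sum span_scale span_base) simp
  with assms show ?thesis
    unfolding closed_span_def closure_sequential sums_def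
    by (intro exI[of _ "\<lambda>n. \<Sum>i<n. s (b i) (y i)"]) simp
qed

lemma basic_sequence_coeff_unique:
  assumes "basic_sequence s y" "(\<lambda>i. s (a i) (y i)) sums z" "(\<lambda>i. s (b i) (y i)) sums z"
  shows "a = b"
  using assms sums_in_closed_span[OF assms(2)]
  unfolding basic_sequence_def schauder_basis_of_def by blast

lemma basis_coeff_eqI:
  assumes "basic_sequence s y" "(\<lambda>i. s (a i) (y i)) sums z"
  shows "basis_coeff s y z = a"
  unfolding basis_coeff_def
  using assms basic_sequence_coeff_unique by (intro the_equality) auto

lemma basis_coeff_sums:
  assumes "schauder_basis_of s y UNIV"
  shows "(\<lambda>i. s (basis_coeff s y u i) (y i)) sums u"
proof -
  have "\<exists>!b. (\<lambda>i. s (b i) (y i)) sums u" using assms by (simp add: schauder_basis_of_def)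
  then show ?thesis unfolding basis_coeff_def by (rule theI')
qed

end

section \<open>A criterion for unconditional basic sequences\<close>

text \<open>
  Unconditionality with constant 1, restricted to the multipliers 0 and 1: shrinking the index
  set of a finite sum does not increase its norm.  This passes from a basis to its block
  sequences, which is why it is isolated here.
\<close>

locale subset_monotone_sequence = normed_scaling_space s
  for s :: "'k::{real_normed_field, banach} \<Rightarrow> 'a::banach \<Rightarrow> 'a" +
  fixes y :: "nat \<Rightarrow> 'a"
  assumes nonzero: "y i \<noteq> 0"
    and subset_mono: "finite G \<Longrightarrow> F \<subseteq> G \<Longrightarrow>
      norm (\<Sum>i\<in>F. s (b i) (y i)) \<le> norm (\<Sum>i\<in>G. s (b i) (y i))"
begin

lemma coeff_bound:
  assumes "finite G" "i \<in> G"
  shows "norm (b i) \<le> norm (\<Sum>i\<in>G. s (b i) (y i)) / norm (y i)"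
  using subset_mono[OF assms(1), of "{i}" b] assms(2) nonzero[of i]
  by (simp add: norm_s field_simps)

lemma sums_unique_coeff:
  assumes "(\<lambda>i. s (a i) (y i)) sums z" "(\<lambda>i. s (b i) (y i)) sums z"
  shows "a = b"
proof
  fix i
  have "(\<lambda>i. s (a i - b i) (y i)) sums 0"
    using sums_diff[OF assms] by (simp add: scale_left_diff_distrib)
  then have "(\<lambda>n. norm (\<Sum>i<n. s (a i - b i) (y i)) / norm (y i)) \<longlonglongrightarrow> 0"
    unfolding sums_def by (intro tendsto_divide_zero tendsto_norm_zero)
  moreover have "\<forall>\<^sub>F n in sequentially. norm (a i - b i) \<le> norm (\<Sum>i<n. s (a i - b i) (y i)) / norm (y i)"
    using eventually_gt_at_top[of i]
    by eventually_elim (intro coeff_bound[where b = "\<lambda>i. a i - b i"], auto)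
  ultimately have "norm (a i - b i) \<le> 0"
    by (intro tendsto_lowerbound) auto
  then show "a i = b i" by simp
qed

text \<open>Approximate \<open>z\<close> by finite sums \<open>zs q\<close> with coefficients \<open>b q\<close>.  Every partial sum of
  \<open>zs q - zs q'\<close> is bounded by \<open>norm (zs q - zs q')\<close>, so each coefficient sequence is Cauchy, and
  the same bound, passed to the limit in \<open>q'\<close>, shows that the series with the limit coefficients
  converges to \<open>z\<close>.\<close>

lemma closed_span_expansion:
  assumes z: "z \<in> closed_span s (range y)"
  shows "\<exists>b. (\<lambda>i. s (b i) (y i)) sums z"
proof -
  obtain zs where zs: "\<And>q. zs q \<in> span (range y)" and lim: "zs \<longlonglongrightarrow> z"
    using z unfolding closed_span_def closure_sequential by blast
  have "\<forall>q. \<exists>n b. zs q = (\<Sum>i<n. s (b i) (y i)) \<and> (\<forall>i\<ge>n. b i = 0)"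
  proof
    fix q
    obtain n b where "zs q = (\<Sum>i<n. s (b i) (y i))" using zs in_span_range_iff by blast
    then have "zs q = (\<Sum>i<n. s (if i < n then b i else 0) (y i)) \<and>
        (\<forall>i\<ge>n. (if i < n then b i else 0) = 0)" by simp
    then show "\<exists>n b. zs q = (\<Sum>i<n. s (b i) (y i)) \<and> (\<forall>i\<ge>n. b i = 0)"
      by (rule exI[of _ "\<lambda>i. if i < n then b i else 0", THEN exI[of _ n]])
  qed
  then obtain n b where zs_eq: "\<And>q. zs q = (\<Sum>i<n q. s (b q i) (y i))"
    and b0: "\<And>q i. i \<ge> n q \<Longrightarrow> b q i = 0" by metis
  have zs_sum: "zs q = (\<Sum>i<m. s (b q i) (y i))" if "m \<ge> n q" for m q
    unfolding zs_eq by (rule sum.mono_neutral_left) (use that b0 in auto)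
  have partial: "norm (\<Sum>i<m. s (b q i - b q' i) (y i)) \<le> norm (zs q - zs q')" for m q q'
  proof -
    let ?M = "Max {m, n q, n q'}"
    have "zs q - zs q' = (\<Sum>i<?M. s (b q i - b q' i) (y i))"
      by (simp add: zs_sum[of q ?M] zs_sum[of q' ?M] scale_left_diff_distrib sum_subtractf)
    then show ?thesis
      using subset_mono[of "{..<?M}" "{..<m}" "\<lambda>i. b q i - b q' i"] by simp
  qed
  have cauchy: "Cauchy zs" using lim LIMSEQ_imp_Cauchy by blast
  have "convergent (\<lambda>q. b q i)" for i
  proof (rule Cauchy_convergent, rule metric_CauchyI)
    fix \<epsilon> :: real assume \<epsilon>: "\<epsilon> > 0"
    then obtain Q where Q: "\<And>q q'. q \<ge> Q \<Longrightarrow> q' \<ge> Q \<Longrightarrow> dist (zs q) (zs q') < \<epsilon> * norm (y i)"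
      using metric_CauchyD[OF cauchy, of "\<epsilon> * norm (y i)"] nonzero[of i] by auto
    have "dist (b q i) (b q' i) < \<epsilon>" if "q \<ge> Q" "q' \<ge> Q" for q q'
    proof -
      have "norm (b q i - b q' i) \<le> norm (\<Sum>i<Suc i. s (b q i - b q' i) (y i)) / norm (y i)"
        using coeff_bound[of "{..<Suc i}" i "\<lambda>i. b q i - b q' i"] by simp
      also have "\<dots> \<le> norm (zs q - zs q') / norm (y i)"
        by (intro divide_right_mono partial) simp
      also have "\<dots> < \<epsilon>" using Q[OF that] nonzero[of i] by (simp add: dist_norm field_simps)
      finally show ?thesis by (simp add: dist_norm)
    qed
    then show "\<exists>Q. \<forall>q\<ge>Q. \<forall>q'\<ge>Q. dist (b q i) (b q' i) < \<epsilon>" by blast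
  qed
  then have "\<forall>i. \<exists>c. (\<lambda>q. b q i) \<longlonglongrightarrow> c" by (simp add: convergent_def)
  then obtain c where c: "\<And>i. (\<lambda>q. b q i) \<longlonglongrightarrow> c i" by metis
  have "(\<lambda>m. \<Sum>i<m. s (c i) (y i)) \<longlonglongrightarrow> z"
  proof (rule LIMSEQ_I)
    fix \<epsilon> :: real assume \<epsilon>: "\<epsilon> > 0"
    then obtain Q where Q: "\<And>q q'. q \<ge> Q \<Longrightarrow> q' \<ge> Q \<Longrightarrow> dist (zs q) (zs q') < \<epsilon>/3"
      using metric_CauchyD[OF cauchy, of "\<epsilon>/3"] by auto
    have "norm (zs Q - z) \<le> \<epsilon>/3"
      by (rule LIMSEQ_le_const2[OF tendsto_norm[OF tendsto_diff[OF tendsto_const lim]]])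
        (intro exI[of _ Q] allI impI less_imp_le, use Q in \<open>simp add: dist_norm\<close>)
    moreover have "norm (\<Sum>i<m. s (b Q i - c i) (y i)) \<le> \<epsilon>/3" for m
    proof (rule LIMSEQ_le_const2[OF tendsto_norm[OF tendsto_sum[OF tendsto_s[OF tendsto_diff[OF tendsto_const c]]]]])
      show "\<exists>N. \<forall>q\<ge>N. norm (\<Sum>i<m. s (b Q i - b q i) (y i)) \<le> \<epsilon>/3"
        by (intro exI[of _ Q] allI impI order.trans[OF partial less_imp_le])
          (use Q in \<open>simp add: dist_norm\<close>)
    qed
    moreover have "norm ((\<Sum>i<m. s (c i) (y i)) - z) \<le>
        norm (zs Q - z) + norm (\<Sum>i<m. s (b Q i - c i) (y i))" if "m \<ge> n Q" for m
      using norm_triangle_ineq4[of "zs Q - z" "\<Sum>i<m. s (b Q i - c i) (y i)"]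
      by (simp add: zs_sum[OF that] scale_left_diff_distrib sum_subtractf)
    ultimately have "norm ((\<Sum>i<m. s (c i) (y i)) - z) \<le> \<epsilon>/3 + \<epsilon>/3" if "m \<ge> n Q" for m
      using that by (meson add_mono order.trans)
    then have "norm ((\<Sum>i<m. s (c i) (y i)) - z) < \<epsilon>" if "m \<ge> n Q" for m
      using that \<epsilon> by fastforce
    then show "\<exists>m0. \<forall>m\<ge>m0. norm ((\<Sum>i<m. s (c i) (y i)) - z) < \<epsilon>" by blast
  qed
  then show ?thesis by (auto simp: sums_def)
qed

lemma basic: "basic_sequence s y"
  unfolding basic_sequence_def schauder_basis_of_def
proof (intro conjI ballI range_subset_closed_span)
  fix z assume "z \<in> closed_span s (range y)"
  show "\<exists>!b. (\<lambda>i. s (b i) (y i)) sums z"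
    by (rule ex_ex1I[OF closed_span_expansion[OF \<open>z \<in> _\<close>] sums_unique_coeff])
qed

text \<open>A late segment of the rearranged series is a sum over a finite set of late indices of the
  original series, hence part of one of its late segments, whose norms are small.\<close>

lemma unconditional: "unconditional s y"
  unfolding unconditional_def
proof (intro conjI basic allI impI)
  fix a :: "nat \<Rightarrow> 'k" and \<pi> :: "nat \<Rightarrow> nat"
  assume sm: "summable (\<lambda>j. s (a j) (y j))" and \<pi>: "bij \<pi>"
  show "summable (\<lambda>j. s (a (\<pi> j)) (y (\<pi> j)))"
    unfolding summable_Cauchy
  proof (intro allI impI)
    fix \<epsilon> :: real assume "\<epsilon> > 0"
    then obtain N where N: "\<And>m n. m \<ge> N \<Longrightarrow> norm (\<Sum>j=m..<n. s (a j) (y j)) < \<epsilon>"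
      using sm unfolding summable_Cauchy by blast
    have "finite (\<pi> -` {..<N})" using \<pi> by (simp add: finite_vimageI bij_is_inj)
    then obtain M where M: "\<pi> -` {..<N} \<subseteq> {..<M}" using finite_nat_iff_bounded by blast
    have small: "norm (\<Sum>j=m..<n. s (a (\<pi> j)) (y (\<pi> j))) < \<epsilon>" if "m \<ge> M" for m n
    proof -
      obtain K where K: "\<pi> ` {m..<n} \<subseteq> {..<K}"
        using finite_nat_iff_bounded[of "\<pi> ` {m..<n}"] by auto
      have "N \<le> \<pi> j" if "j \<ge> m" for j
      proof (rule ccontr)
        assume "\<not> N \<le> \<pi> j"
        then have "j < M" using subsetD[OF M, of j] by simp
        with \<open>m \<ge> M\<close> \<open>j \<ge> m\<close> show False by simp
      qed
      then have sub: "\<pi> ` {m..<n} \<subseteq> {N..<K}" using K by (simp add: image_subset_iff)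
      have "norm (\<Sum>j\<in>\<pi> ` {m..<n}. s (a j) (y j)) \<le> norm (\<Sum>j=N..<K. s (a j) (y j))"
        by (rule subset_mono[OF finite_atLeastLessThan sub])
      also have "\<dots> < \<epsilon>" using N by simp
      finally have "norm (\<Sum>j\<in>\<pi> ` {m..<n}. s (a j) (y j)) < \<epsilon>" .
      moreover have "norm (\<Sum>j\<in>\<pi> ` {m..<n}. s (a j) (y j)) = norm (\<Sum>j=m..<n. s (a (\<pi> j)) (y (\<pi> j)))"
        by (subst sum.reindex[OF inj_on_subset[OF bij_is_inj[OF \<pi>] subset_UNIV]]) simp
      ultimately show ?thesis by simp
    qed
    show "\<exists>M. \<forall>m\<ge>M. \<forall>n. norm (\<Sum>j=m..<n. s (a (\<pi> j)) (y (\<pi> j))) < \<epsilon>"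
      by (rule exI[of _ M], intro allI impI, rule small)
  qed
qed

end

section \<open>One-subsymmetric sequences\<close>

locale one_subsymmetric_sequence = normed_scaling_space s
  for s :: "'k::{real_normed_field, banach} \<Rightarrow> 'a::banach \<Rightarrow> 'a" +
  fixes e :: "nat \<Rightarrow> 'a"
  assumes one_subsymmetric: "one_subsymmetric s e"
begin

lemma basic_e: "basic_sequence s e"
  using one_subsymmetric by (simp add: one_subsymmetric_def one_unconditional_def)

lemma norm_sign_change:
  assumes "finite S" and \<epsilon>: "\<And>j. \<epsilon> j = 1 \<or> \<epsilon> j = -1"
  shows "norm (\<Sum>j\<in>S. s (\<epsilon> j * a j) (e j)) = norm (\<Sum>j\<in>S. s (a j) (e j))"
proof -
  obtain n where n: "S \<subseteq> {..<n}" using assms(1) finite_nat_iff_bounded by blast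
  have extend: "(\<Sum>j\<in>S. s (f j) (e j)) = (\<Sum>j<n. s (if j \<in> S then f j else 0) (e j))" for f
    by (rule sum.mono_neutral_cong_left) (use n in auto)
  have "norm (\<Sum>j<n. s (\<epsilon> j * (if j \<in> S then a j else 0)) (e j))
      = norm (\<Sum>j<n. s (if j \<in> S then a j else 0) (e j))"
    using one_subsymmetric \<epsilon> by (simp add: one_subsymmetric_def one_unconditional_def)
  moreover have "\<epsilon> j * (if j \<in> S then a j else 0) = (if j \<in> S then \<epsilon> j * a j else 0)" for j
    by simp
  ultimately show ?thesis by (simp add: extend)
qed

text \<open>Change the multipliers one coordinate at a time.  A vector whose \<open>i\<close>-th coordinate is multiplied
  by \<open>\<theta> i \<in> [-1, 1]\<close> is a convex combination of the original vector and the one with the sign of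
  that coordinate flipped, and these two have the same norm.\<close>

lemma norm_multiplier_le:
  assumes "finite S" and \<theta>: "\<And>j. j \<in> S \<Longrightarrow> \<bar>\<theta> j\<bar> \<le> 1"
  shows "norm (\<Sum>j\<in>S. \<theta> j *\<^sub>R s (a j) (e j)) \<le> norm (\<Sum>j\<in>S. s (a j) (e j))"
proof -
  have "norm (\<Sum>j\<in>S. (if j \<in> T then \<theta> j else 1) *\<^sub>R s (a j) (e j)) \<le> norm (\<Sum>j\<in>S. s (a j) (e j))"
    if "finite T" "T \<subseteq> S" for T
    using that
  proof (induction T)
    case empty
    then show ?case by simp
  next
    case (insert i T)
    define \<mu> where "\<mu> j = (if j \<in> T then \<theta> j else 1)" for j
    define u where "u = (\<Sum>j\<in>S. \<mu> j *\<^sub>R s (a j) (e j))"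
    define u' where "u' = (\<Sum>j\<in>S. (if j = i then -1 else 1) *\<^sub>R \<mu> j *\<^sub>R s (a j) (e j))"
    have "u' = (\<Sum>j\<in>S. s ((if j = i then -1 else 1) * (of_real (\<mu> j) * a j)) (e j))"
      unfolding u'_def by (intro sum.cong refl) (auto simp: s_of_real_mult)
    then have "norm u' = norm (\<Sum>j\<in>S. s (of_real (\<mu> j) * a j) (e j))"
      using norm_sign_change[OF assms(1), of "\<lambda>j. if j = i then -1 else 1"] by simp
    then have eq: "norm u' = norm u" by (simp add: u_def s_of_real_mult)
    have "(\<Sum>j\<in>S. (if j \<in> insert i T then \<theta> j else 1) *\<^sub>R s (a j) (e j))
        = ((1 + \<theta> i)/2) *\<^sub>R u + ((1 - \<theta> i)/2) *\<^sub>R u'"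
      unfolding u_def u'_def scaleR_sum_right sum.distrib[symmetric]
      using insert.hyps by (intro sum.cong refl)
        (auto simp: \<mu>_def scaleR_left_distrib[symmetric] scaleR_left_diff_distrib[symmetric] add_divide_distrib[symmetric]
              diff_divide_distrib[symmetric] field_simps)
    also have "norm \<dots> \<le> \<bar>(1 + \<theta> i)/2\<bar> * norm u + \<bar>(1 - \<theta> i)/2\<bar> * norm u"
      using norm_triangle_ineq[of "((1 + \<theta> i)/2) *\<^sub>R u" "((1 - \<theta> i)/2) *\<^sub>R u'"] by (simp add: eq)
    also have "\<dots> = norm u"
    proof -
      have "\<bar>\<theta> i\<bar> \<le> 1" using insert.prems \<theta> by simp
      then have "\<bar>(1 + \<theta> i)/2\<bar> = (1 + \<theta> i)/2" "\<bar>(1 - \<theta> i)/2\<bar> = (1 - \<theta> i)/2" by simp_all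
      then show ?thesis by (simp only:) (simp add: field_simps)
    qed
    also have "\<dots> \<le> norm (\<Sum>j\<in>S. s (a j) (e j))"
      using insert unfolding u_def \<mu>_def by simp
    finally show ?case .
  qed
  from this[of S] assms(1) show ?thesis by simp
qed

lemma norm_subsequence:
  assumes r: "strict_mono_on {..<n} r"
  shows "norm (\<Sum>i<n. s (a i) (e (r i))) = norm (\<Sum>i<n. s (a i) (e i))"
proof -
  \<comment> \<open>Isometric equivalence speaks of subsequences, so \<open>r\<close> is continued to a strictly increasing map.\<close>
  define R where "R i = (if i < n then r i else (\<Sum>j<n. r j) + i)" for i
  have le: "r i \<le> (\<Sum>j<n. r j)" if "i < n" for i
    using that by (intro member_le_sum) auto
  have "strict_mono R"
  proof (rule strict_monoI)
    fix i j :: nat assume "i < j"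
    then show "R i < R j"
      using strict_mono_onD[OF r, of i j] le[of i] by (auto simp: R_def)
  qed
  then have "norm (\<Sum>i<n. s (a i) (e i)) = norm (\<Sum>i<n. s (a i) ((e \<circ> R) i))"
    using one_subsymmetric by (simp add: one_subsymmetric_def isometrically_equivalent_def)
  then show ?thesis by (simp add: R_def)
qed

text \<open>The norm of a finite sum depends only on the order in which its coefficients occur.  The indices
  come from an arbitrary type because the blocks below are naturally indexed by pairs.\<close>

lemma norm_reposition:
  fixes \<phi> \<psi> :: "'i \<Rightarrow> nat"
  assumes "finite S" "inj_on \<phi> S"
    and mono: "\<And>\<alpha> \<beta>. \<alpha> \<in> S \<Longrightarrow> \<beta> \<in> S \<Longrightarrow> \<phi> \<alpha> < \<phi> \<beta> \<Longrightarrow> \<psi> \<alpha> < \<psi> \<beta>"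
  shows "norm (\<Sum>\<alpha>\<in>S. s (f \<alpha>) (e (\<phi> \<alpha>))) = norm (\<Sum>\<alpha>\<in>S. s (f \<alpha>) (e (\<psi> \<alpha>)))"
proof -
  obtain h where h: "bij_betw h {..<card (\<phi> ` S)} (\<phi> ` S)"
    and hm: "strict_mono_on {..<card (\<phi> ` S)} h"
    using ex_bij_betw_strict_mono_card[OF finite_imageI[OF assms(1), of \<phi>]] by metis
  define n where "n = card (\<phi> ` S)"
  define g where "g = inv_into S \<phi> \<circ> h"
  have g: "bij_betw g {..<n} S"
    unfolding g_def
    by (rule bij_betw_trans[of _ _ "\<phi> ` S"])
      (use h assms(2) in \<open>auto simp: n_def intro!: bij_betw_inv_into inj_on_imp_bij_betw\<close>)
  have \<phi>g: "\<phi> (g i) = h i" if "i < n" for i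
    using that bij_betwE[OF h] unfolding g_def n_def by (simp add: f_inv_into_f)
  have mono_\<phi>: "strict_mono_on {..<n} (\<phi> \<circ> g)"
    using hm by (auto simp: strict_mono_on_def \<phi>g n_def)
  moreover have "strict_mono_on {..<n} (\<psi> \<circ> g)"
    using mono_\<phi> mono bij_betwE[OF g] by (auto simp: strict_mono_on_def)
  ultimately have "norm (\<Sum>i<n. s (f (g i)) (e ((\<phi> \<circ> g) i))) = norm (\<Sum>i<n. s (f (g i)) (e ((\<psi> \<circ> g) i)))"
    by (simp only: norm_subsequence)
  moreover have "(\<Sum>i<n. s (f (g i)) (e ((\<xi> \<circ> g) i))) = (\<Sum>\<alpha>\<in>S. s (f \<alpha>) (e (\<xi> \<alpha>)))" for \<xi>
    using sum.reindex_bij_betw[OF g, of "\<lambda>\<alpha>. s (f \<alpha>) (e (\<xi> \<alpha>))"] by simp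
  ultimately show ?thesis by simp
qed

text \<open>Moving coefficients to other places in the same order, dropping some of them and shrinking
  the weights of the others can only decrease the norm.  All comparisons between different block
  sequences reduce to this.\<close>

lemma norm_weight_mono:
  fixes \<phi> \<psi> :: "'i \<Rightarrow> nat"
  assumes T: "finite T" "S \<subseteq> T" and \<phi>: "inj_on \<phi> S" and \<psi>: "inj_on \<psi> T"
    and mono: "\<And>\<alpha> \<beta>. \<alpha> \<in> S \<Longrightarrow> \<beta> \<in> S \<Longrightarrow> \<phi> \<alpha> < \<phi> \<beta> \<Longrightarrow> \<psi> \<alpha> < \<psi> \<beta>"
    and weights: "\<And>\<alpha>. \<alpha> \<in> S \<Longrightarrow> 0 \<le> \<theta> \<alpha> \<and> \<theta> \<alpha> \<le> \<mu> \<alpha>"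
  shows "norm (\<Sum>\<alpha>\<in>S. \<theta> \<alpha> *\<^sub>R s (h \<alpha>) (e (\<phi> \<alpha>))) \<le> norm (\<Sum>\<alpha>\<in>T. \<mu> \<alpha> *\<^sub>R s (h \<alpha>) (e (\<psi> \<alpha>)))"
proof -
  let ?\<rho> = "\<lambda>\<alpha>. if \<alpha> \<in> S then \<theta> \<alpha> / \<mu> \<alpha> else 0"
  let ?g = "inv_into T \<psi>"
  have "norm (\<Sum>\<alpha>\<in>S. \<theta> \<alpha> *\<^sub>R s (h \<alpha>) (e (\<phi> \<alpha>))) = norm (\<Sum>\<alpha>\<in>S. \<theta> \<alpha> *\<^sub>R s (h \<alpha>) (e (\<psi> \<alpha>)))"
    using norm_reposition[of S \<phi> \<psi> "\<lambda>\<alpha>. of_real (\<theta> \<alpha>) * h \<alpha>"] T \<phi> mono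
    by (simp add: s_of_real_mult finite_subset)
  also have "(\<Sum>\<alpha>\<in>S. \<theta> \<alpha> *\<^sub>R s (h \<alpha>) (e (\<psi> \<alpha>))) = (\<Sum>\<alpha>\<in>T. ?\<rho> \<alpha> *\<^sub>R \<mu> \<alpha> *\<^sub>R s (h \<alpha>) (e (\<psi> \<alpha>)))"
    by (rule sum.mono_neutral_cong_left) (use T weights in \<open>fastforce+\<close>)
  also have "\<dots> = (\<Sum>j\<in>\<psi> ` T. ?\<rho> (?g j) *\<^sub>R s (of_real (\<mu> (?g j)) * h (?g j)) (e j))"
    using \<psi> by (auto simp: sum.reindex s_of_real_mult intro!: sum.cong)
  also have "norm \<dots> \<le> norm (\<Sum>j\<in>\<psi> ` T. s (of_real (\<mu> (?g j)) * h (?g j)) (e j))"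
  proof (rule norm_multiplier_le)
    show "finite (\<psi> ` T)" using T by simp
    fix j assume "j \<in> \<psi> ` T"
    show "\<bar>?\<rho> (?g j)\<bar> \<le> 1" using weights[of "?g j"] by (auto simp: divide_le_eq_1)
  qed
  also have "(\<Sum>j\<in>\<psi> ` T. s (of_real (\<mu> (?g j)) * h (?g j)) (e j)) = (\<Sum>\<alpha>\<in>T. \<mu> \<alpha> *\<^sub>R s (h \<alpha>) (e (\<psi> \<alpha>)))"
    using \<psi> by (simp add: sum.reindex s_of_real_mult)
  finally show ?thesis .
qed

end

section \<open>Auxiliary facts on series and on concatenation\<close>

lemma summable_if_norm_le:
  fixes f :: "nat \<Rightarrow> 'a::banach" and g :: "nat \<Rightarrow> 'b::banach"
  assumes f: "summable f" and t: "t \<longlonglongrightarrow> 0"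
    and le: "\<And>m n. norm (sum g {m..<n}) \<le> norm (sum f {m..<n}) + t m"
  shows "summable g"
  unfolding summable_Cauchy
proof (intro allI impI)
  fix \<epsilon> :: real assume "\<epsilon> > 0"
  then have half: "\<epsilon>/2 > 0" by simp
  obtain M where M: "\<And>m n. m \<ge> M \<Longrightarrow> norm (sum f {m..<n}) < \<epsilon>/2"
    using f half unfolding summable_Cauchy by meson
  have "\<forall>\<^sub>F m in sequentially. t m < \<epsilon>/2" using order_tendstoD(2)[OF t half] .
  then obtain M' where M': "\<And>m. m \<ge> M' \<Longrightarrow> t m < \<epsilon>/2"
    unfolding eventually_sequentially by meson
  have "norm (sum g {m..<n}) < \<epsilon>" if "m \<ge> max M M'" for m n
    using le[of m n] M[of m n] M'[of m] that by simp
  then show "\<exists>M. \<forall>m\<ge>M. \<forall>n. norm (sum g {m..<n}) < \<epsilon>"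
    by meson
qed

lemma sum_half_powers_le: "(\<Sum>k\<in>{m<..n}. 1/2^k) \<le> (1/2^m :: real)"
proof -
  have "(\<Sum>k\<in>{m<..n}. 1/2^k) \<le> (1/2^m - 1/2^n :: real)" if "m \<le> n"
    using that
  proof (induction n rule: dec_induct)
    case (step n)
    have "{m<..Suc n} = insert (Suc n) {m<..n}" using step.hyps by auto
    then show ?case using step.IH by simp
  qed simp
  then show ?thesis
    by (cases "m \<le> n") (auto intro: order.trans)
qed

lemma sum_half_powers_atLeast_le: "(\<Sum>k=m..<n. 1/2^k) \<le> (2/2^m :: real)"
proof (cases "m < n")
  case True
  then have "{m..<n} = insert m {m<..n-1}" by auto
  then show ?thesis using sum_half_powers_le[of m "n-1"] by simp
qed simp

lemma concatenation_exists:
  fixes h :: "nat \<Rightarrow> nat \<Rightarrow> 'c"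
  shows "\<exists>f. \<forall>k j. j < l k \<longrightarrow> f ((\<Sum>i<k. l i) + j) = h k j"
proof -
  define p where "p k = (\<Sum>i<k. l i)" for k
  define K where "K i = (LEAST k. i < p (Suc k))" for i
  have mono: "p (Suc k') \<le> p k" if "k' < k" for k k'
    unfolding p_def by (rule sum_mono2) (use that in auto)
  have "K (p k + j) = k" if "j < l k" for k j
    unfolding K_def
  proof (rule Least_equality)
    show "p k + j < p (Suc k)" using that by (simp add: p_def)
    show "k \<le> k'" if "p k + j < p (Suc k')" for k'
      using mono[of k' k] that by (meson le_add1 not_le order.strict_trans1 order.strict_trans2 order.asym)
  qed
  then have "\<forall>k j. j < l k \<longrightarrow> h (K (p k + j)) (p k + j - p (K (p k + j))) = h k j" by simp
  then show ?thesis
    by (intro exI[of _ "\<lambda>i. h (K i) (i - p (K i))"]) (simp add: p_def)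
qed

text \<open>The intervals \<open>{P i..<P i + l i}\<close> for \<open>i \<in> F\<close> follow one another from left to right.\<close>

definition separated :: "nat set \<Rightarrow> (nat \<Rightarrow> nat) \<Rightarrow> (nat \<Rightarrow> nat) \<Rightarrow> bool" where
  "separated F l P \<longleftrightarrow> (\<forall>i\<in>F. \<forall>i'\<in>F. i < i' \<longrightarrow> P i + l i \<le> P i')"

lemma separatedD:
  assumes "separated F l P" "i \<in> F" "i' \<in> F" "j < l i" "j' < l i'" "P i + j \<le> P i' + j'"
  shows "i < i' \<or> i = i' \<and> j \<le> j'"
proof (rule ccontr)
  assume "\<not> ?thesis"
  then consider "i' < i" | "i = i'" "j' < j" by linarith
  then show False
  proof cases
    case 1
    then have "P i' + l i' \<le> P i" using assms by (simp add: separated_def)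
    then show False using assms by linarith
  qed (use assms in simp)
qed

section \<open>Block sequences built from truncations of one vector\<close>

text \<open>
  The data produced by the inductive choice.  \<open>a\<close> are the coefficients of \<open>x\<close>, \<open>N k\<close> is the
  length of the \<open>k\<close>-th truncation of \<open>x\<close> and \<open>c k\<close> its weight; \<open>d k\<close> is a scalar sequence of
  length \<open>L k\<close>, the \<open>k\<close>-th witness.  Against consecutive copies of the weighted \<open>k\<close>-th
  truncation the witness has norm at least 1.  Its norm against \<open>e\<close> is so small that all earlier
  truncations together contribute at most \<open>1/2^k\<close>, where \<open>c k' * (\<Sum>j<N k'. norm (a j))\<close> is the
  crude bound for the operator from \<open>e\<close> to the copies of the \<open>k'\<close>-th one.  The later weights
  are chosen after the witness, and so small that even the triangle inequality gives a small
  contribution.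
\<close>

locale block_tower = one_subsymmetric_sequence s e
  for s :: "'k::{real_normed_field, banach} \<Rightarrow> 'a::banach \<Rightarrow> 'a" and e +
  fixes a :: "nat \<Rightarrow> 'k" and N :: "nat \<Rightarrow> nat" and c :: "nat \<Rightarrow> real"
    and L :: "nat \<Rightarrow> nat" and d :: "nat \<Rightarrow> nat \<Rightarrow> 'k"
  assumes truncation_le_1: "norm (\<Sum>j<m. s (a j) (e j)) \<le> 1"
    and N_mono: "mono N" and N_pos: "0 < N k"
    and c_pos: "0 < c k" and c_le: "c k \<le> 1/2^k"
    and L_pos: "0 < L k"
    and witness_large:
      "1 \<le> c k * norm (\<Sum>i<L k. \<Sum>j<N k. s (d k i * a j) (e (i * N k + j)))"
    and witness_small:
      "(\<Sum>k'<k. c k' * (\<Sum>j<N k'. norm (a j))) * norm (\<Sum>i<L k. s (d k i) (e i)) \<le> 1/2^k"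
    and later_weight_small: "k < k' \<Longrightarrow> c k' * (\<Sum>i<L k. norm (d k i)) \<le> 1/2^k'"
begin

definition copy :: "nat \<Rightarrow> nat \<Rightarrow> 'a" where
  "copy k q = (\<Sum>j<N k. s (a j) (e (q + j)))"

text \<open>The vector \<open>\<Sum>k\<in>A. c k *\<^sub>R P\<^sub>k x\<close>, where \<open>P\<^sub>k\<close> truncates at \<open>N k\<close>, with the terms after
  \<open>m\<close> left out so that it has finite support, and moved to start at \<open>q\<close>.\<close>

definition mixture :: "nat set \<Rightarrow> nat \<Rightarrow> nat \<Rightarrow> 'a" where
  "mixture A m q = (\<Sum>k\<in>A \<inter> {..m}. c k *\<^sub>R copy k q)"

definition weight :: "nat set \<Rightarrow> nat \<Rightarrow> nat \<Rightarrow> real" where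
  "weight A m j = (\<Sum>k | k \<in> A \<inter> {..m} \<and> j < N k. c k)"

lemma s_copy: "s b (copy k q) = (\<Sum>j<N k. s (b * a j) (e (q + j)))"
  by (simp add: copy_def scale_sum_right)

text \<open>All truncations start at the same place, so that the sum of several of them is again a
  truncation of \<open>x\<close> with nonnegative real weights on its coordinates.\<close>

lemma mixture_eq_weights: "mixture A m q = (\<Sum>j<N m. weight A m j *\<^sub>R s (a j) (e (q + j)))"
proof -
  have "copy k q = (\<Sum>j<N m. if j < N k then s (a j) (e (q + j)) else 0)" if "k \<le> m" for k
    unfolding copy_def using monoD[OF N_mono that]
    by (intro sum.mono_neutral_cong_left) auto
  then have "mixture A m q = (\<Sum>k\<in>A \<inter> {..m}. \<Sum>j<N m. if j < N k then c k *\<^sub>R s (a j) (e (q + j)) else 0)"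
    unfolding mixture_def by (auto simp: scaleR_sum_right intro!: sum.cong)
  also have "\<dots> = (\<Sum>j<N m. \<Sum>k\<in>A \<inter> {..m}. if j < N k then c k *\<^sub>R s (a j) (e (q + j)) else 0)"
    by (rule sum.swap)
  also have "\<dots> = (\<Sum>j<N m. weight A m j *\<^sub>R s (a j) (e (q + j)))"
    unfolding weight_def scaleR_left.sum by (intro sum.cong refl sum.inter_filter[symmetric]) simp
  finally show ?thesis .
qed

lemma weight_nonneg: "0 \<le> weight A m j"
  unfolding weight_def using c_pos less_imp_le by (intro sum_nonneg) blast

lemma weight_mono: "A \<subseteq> A' \<Longrightarrow> m \<le> m' \<Longrightarrow> weight A m j \<le> weight A' m' j"
  unfolding weight_def using c_pos less_imp_le by (intro sum_mono2) auto

text \<open>Enlarging \<open>A\<close>, the cut-off or the index set increases the weights, and the position of the copies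
  is irrelevant as long as they do not overlap.\<close>

lemma norm_mixture_mono:
  assumes "finite G" "F \<subseteq> G" "A \<subseteq> A'" and m: "\<And>i. i \<in> F \<Longrightarrow> m i \<le> m' i"
    and P: "separated F (\<lambda>i. N (m i)) P" and Q: "separated G (\<lambda>i. N (m' i)) Q"
  shows "norm (\<Sum>i\<in>F. s (h i) (mixture A (m i) (P i))) \<le> norm (\<Sum>i\<in>G. s (h i) (mixture A' (m' i) (Q i)))"
proof -
  have flatten: "(\<Sum>i\<in>H. s (h i) (mixture C (M i) (R i))) =
      (\<Sum>\<alpha>\<in>Sigma H (\<lambda>i. {..<N (M i)}). weight C (M (fst \<alpha>)) (snd \<alpha>) *\<^sub>R
        s (h (fst \<alpha>) * a (snd \<alpha>)) (e (R (fst \<alpha>) + snd \<alpha>)))" if "finite H" for H C M R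
    using that by (simp add: mixture_eq_weights scale_sum_right s_scaleR sum.Sigma case_prod_beta)
  let ?S = "Sigma F (\<lambda>i. {..<N (m i)})" and ?T = "Sigma G (\<lambda>i. {..<N (m' i)})"
  let ?\<phi> = "\<lambda>\<alpha>. P (fst \<alpha>) + snd \<alpha>" and ?\<psi> = "\<lambda>\<alpha>. Q (fst \<alpha>) + snd \<alpha>"
  have N_le: "N (m i) \<le> N (m' i)" if "i \<in> F" for i
    using monoD[OF N_mono m[OF that]] .
  have sub: "?S \<subseteq> ?T" using assms(2) N_le by (auto intro: order.strict_trans2)
  have inj: "inj_on (\<lambda>\<alpha>. R (fst \<alpha>) + snd \<alpha>) (Sigma H (\<lambda>i. {..<l i}))"
    if R: "separated H l R" for H R l
  proof (rule inj_onI)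
    fix \<alpha> \<beta> assume \<alpha>: "\<alpha> \<in> Sigma H (\<lambda>i. {..<l i})" and \<beta>: "\<beta> \<in> Sigma H (\<lambda>i. {..<l i})"
      and eq: "R (fst \<alpha>) + snd \<alpha> = R (fst \<beta>) + snd \<beta>"
    have "fst \<alpha> \<in> H" "snd \<alpha> < l (fst \<alpha>)" using \<alpha> by auto
    moreover have "fst \<beta> \<in> H" "snd \<beta> < l (fst \<beta>)" using \<beta> by auto
    ultimately have "fst \<alpha> < fst \<beta> \<or> fst \<alpha> = fst \<beta> \<and> snd \<alpha> \<le> snd \<beta>"
      "fst \<beta> < fst \<alpha> \<or> fst \<beta> = fst \<alpha> \<and> snd \<beta> \<le> snd \<alpha>"
      using separatedD[OF R] eq by simp_all
    then have "fst \<alpha> = fst \<beta> \<and> snd \<alpha> = snd \<beta>" by linarith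
    then show "\<alpha> = \<beta>" by (simp add: prod_eq_iff)
  qed
  have "norm (\<Sum>\<alpha>\<in>?S. weight A (m (fst \<alpha>)) (snd \<alpha>) *\<^sub>R s (h (fst \<alpha>) * a (snd \<alpha>)) (e (?\<phi> \<alpha>)))
      \<le> norm (\<Sum>\<alpha>\<in>?T. weight A' (m' (fst \<alpha>)) (snd \<alpha>) *\<^sub>R s (h (fst \<alpha>) * a (snd \<alpha>)) (e (?\<psi> \<alpha>)))"
  proof (rule norm_weight_mono[OF _ sub inj[OF P] inj[OF Q]])
    show "finite ?T" using assms(1) by simp
  next
    fix \<alpha> \<beta> assume \<alpha>: "\<alpha> \<in> ?S" and \<beta>: "\<beta> \<in> ?S" and less: "?\<phi> \<alpha> < ?\<phi> \<beta>"
    have "fst \<alpha> < fst \<beta> \<or> fst \<alpha> = fst \<beta> \<and> snd \<alpha> \<le> snd \<beta>"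
      using separatedD[OF P, of "fst \<alpha>" "fst \<beta>" "snd \<alpha>" "snd \<beta>"] \<alpha> \<beta> less by auto
    then show "?\<psi> \<alpha> < ?\<psi> \<beta>"
    proof
      assume lt: "fst \<alpha> < fst \<beta>"
      have "\<alpha> \<in> ?T" "\<beta> \<in> ?T" using sub \<alpha> \<beta> by (simp_all only: subsetD)
      then have "Q (fst \<alpha>) + N (m' (fst \<alpha>)) \<le> Q (fst \<beta>)" "snd \<alpha> < N (m' (fst \<alpha>))"
        using Q lt by (auto simp: separated_def)
      then show ?thesis by linarith
    next
      assume "fst \<alpha> = fst \<beta> \<and> snd \<alpha> \<le> snd \<beta>"
      then show ?thesis using less by simp
    qed
  next
    fix \<alpha> assume "\<alpha> \<in> ?S"
    then show "0 \<le> weight A (m (fst \<alpha>)) (snd \<alpha>) \<and>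
        weight A (m (fst \<alpha>)) (snd \<alpha>) \<le> weight A' (m' (fst \<alpha>)) (snd \<alpha>)"
      using m weight_nonneg weight_mono[OF assms(3)] by auto
  qed
  then show ?thesis using assms(1) finite_subset[OF assms(2,1)] by (simp add: flatten)
qed

lemma norm_copy_le_1: "norm (copy k q) \<le> 1"
proof -
  have "norm (copy k q) = norm (\<Sum>j<N k. s (a j) (e j))"
    unfolding copy_def by (intro norm_subsequence[where r = "\<lambda>j. q + j"]) (simp add: strict_mono_on_def)
  then show ?thesis using truncation_le_1 by simp
qed

lemma norm_mixture_diff_le:
  assumes "m \<le> m'"
  shows "norm (mixture A m' q - mixture A m q) \<le> (\<Sum>k\<in>{m<..m'}. c k)"
proof -
  have "A \<inter> {..m'} = (A \<inter> {..m}) \<union> (A \<inter> {m<..m'})" using assms by auto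
  then have "mixture A m' q = mixture A m q + (\<Sum>k\<in>A \<inter> {m<..m'}. c k *\<^sub>R copy k q)"
    unfolding mixture_def by (simp only:) (subst sum.union_disjoint, auto)
  then have "norm (mixture A m' q - mixture A m q) \<le> (\<Sum>k\<in>A \<inter> {m<..m'}. norm (c k *\<^sub>R copy k q))"
    by (simp only: add_diff_cancel_left' norm_sum)
  also have "\<dots> \<le> (\<Sum>k\<in>A \<inter> {m<..m'}. c k)"
    using norm_copy_le_1 c_pos less_imp_le
    by (intro sum_mono) (simp add: abs_of_pos mult_left_le)
  also have "\<dots> \<le> (\<Sum>k\<in>{m<..m'}. c k)"
    using c_pos less_imp_le by (intro sum_mono2) auto
  finally show ?thesis .
qed

definition start :: "nat \<Rightarrow> nat" where "start i = (\<Sum>k<i. N k)"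

definition block :: "nat set \<Rightarrow> nat \<Rightarrow> 'a" where "block A i = mixture A i (start i)"

lemma start_add_N_le: "i < i' \<Longrightarrow> start i + N i \<le> start i'"
  unfolding start_def using sum_mono2[of "{..<i'}" "{..<Suc i}" N] by fastforce

lemma separated_start: "separated F N start"
  by (simp add: separated_def start_add_N_le)

lemma strict_mono_start: "strict_mono start"
  using start_add_N_le N_pos by (metis strict_monoI add_less_cancel_left add.right_neutral order.strict_trans2)

text \<open>Otherwise all copies of the first truncation vanish, against the lower bound for the witness
  \<open>d 0\<close>.\<close>

lemma norm_first_mixture_pos: "0 < norm (mixture {0} 0 0)"
proof (rule ccontr)
  assume "\<not> ?thesis"
  then have zero: "norm (mixture {0} 0 0) = 0" by simp
  have "norm (s 1 (mixture {0} 0 q)) \<le> norm (s 1 (mixture {0} 0 0))" for q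
    using norm_mixture_mono[of "{0}" "{0}" "{0}" "{0}" "\<lambda>_. 0" "\<lambda>_. 0" "\<lambda>_. q" "\<lambda>_. 0" "\<lambda>_. 1"]
    by (simp add: separated_def)
  then have "mixture {0} 0 q = 0" for q using zero by simp
  then have "copy 0 q = 0" for q using c_pos[of 0] by (auto simp: mixture_def)
  then have "(\<Sum>i<L 0. \<Sum>j<N 0. s (d 0 i * a j) (e (i * N 0 + j))) = 0"
    by (simp add: s_copy[symmetric])
  then show False using witness_large[of 0] by simp
qed

text \<open>
  If \<open>0 \<in> A\<close>, all blocks contain a copy of one fixed nonzero vector, so that their norms are
  bounded below.
\<close>

context
  fixes A :: "nat set"
  assumes zero_in: "0 \<in> A"
begin

lemma norm_block_ge: "norm (mixture {0} 0 0) \<le> norm (block A i)"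
  using norm_mixture_mono[of "{i}" "{i}" "{0}" A "\<lambda>_. 0" "\<lambda>i. i" "\<lambda>_. 0" start "\<lambda>_. 1"] zero_in
  by (simp add: separated_def block_def)

lemma subset_monotone_block: "subset_monotone_sequence s (block A)"
proof
  show "block A i \<noteq> 0" for i using norm_block_ge[of i] norm_first_mixture_pos by auto
  show "norm (\<Sum>i\<in>F. s (b i) (block A i)) \<le> norm (\<Sum>i\<in>G. s (b i) (block A i))"
    if "finite G" "F \<subseteq> G" for F G b
    unfolding block_def using that by (intro norm_mixture_mono separated_start) auto
qed

lemma block_basis_block: "block_basis s e (block A)"
proof -
  obtain f where f: "\<And>i j. j < N i \<Longrightarrow> f (start i + j) = of_real (weight A i j) * a j"
    using concatenation_exists[of N "\<lambda>i j. of_real (weight A i j) * a j"] unfolding start_def by metis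
  have "block A i = (\<Sum>k\<in>{start i..<start (Suc i)}. s (f k) (e k))" for i
  proof -
    have "(\<Sum>k\<in>{start i..<start (Suc i)}. s (f k) (e k)) = (\<Sum>j<N i. s (f (start i + j)) (e (start i + j)))"
      by (simp add: sum.atLeastLessThan_shift_0 start_def atLeast0LessThan)
    then show ?thesis by (simp add: block_def mixture_eq_weights f s_of_real_mult)
  qed
  moreover have "block A i \<noteq> 0" for i
    using subset_monotone_block by (rule subset_monotone_sequence.nonzero)
  ultimately show ?thesis
    unfolding block_basis_def using strict_mono_start by (intro exI[of _ start] exI[of _ f]) simp
qed

text \<open>The block \<open>block A (r j)\<close> is a copy of \<open>block A j\<close> except for the terms between \<open>j\<close> and \<open>r j\<close>.
  The additional terms can only increase norms, which gives one direction.  For the other one, their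
  norm is at most \<open>1/2^j\<close>, and since the coefficients of a convergent series of blocks are bounded,
  they form an absolutely convergent series.\<close>

lemma subsymmetric_block: "subsymmetric s (block A)"
  unfolding subsymmetric_def
proof (intro conjI allI impI)
  show "unconditional s (block A)"
    using subset_monotone_block by (rule subset_monotone_sequence.unconditional)
  fix r :: "nat \<Rightarrow> nat" assume r: "strict_mono r"
  have r_ge: "i \<le> r i" for i using strict_mono_imp_increasing[OF r] .
  have sep_r: "separated F (\<lambda>i. N (r i)) (\<lambda>i. start (r i))" for F
    using r start_add_N_le by (simp add: separated_def strict_monoD)
  have sep_r': "separated F N (\<lambda>i. start (r i))" for F
    unfolding separated_def
  proof (intro ballI impI)
    fix i i' :: nat assume "i < i'"
    then have "start (r i) + N (r i) \<le> start (r i')" using r start_add_N_le by (simp add: strict_monoD)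
    then show "start (r i) + N i \<le> start (r i')" using monoD[OF N_mono r_ge[of i]] by linarith
  qed
  show "equivalent_sequences s (block A) (block A \<circ> r)"
    unfolding equivalent_sequences_def
  proof (intro allI iffI)
    fix b :: "nat \<Rightarrow> 'k"
    assume sm: "summable (\<lambda>j. s (b j) ((block A \<circ> r) j))"
    show "summable (\<lambda>j. s (b j) (block A j))"
    proof (rule summable_if_norm_le[OF sm tendsto_const])
      show "norm (\<Sum>j=m..<n. s (b j) (block A j)) \<le> norm (\<Sum>j=m..<n. s (b j) ((block A \<circ> r) j)) + 0" for m n
        unfolding block_def comp_def add_0_right
        by (intro norm_mixture_mono separated_start sep_r r_ge) auto
    qed
  next
    fix b :: "nat \<Rightarrow> 'k"
    assume sm: "summable (\<lambda>j. s (b j) (block A j))"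
    obtain K where K: "\<And>j. norm (s (b j) (block A j)) \<le> K"
      using convergent_imp_Bseq[OF convergentI[OF summable_LIMSEQ_zero[OF sm]]] by (meson BseqE)
    define M where "M = K / norm (mixture {0} 0 0)"
    have M: "norm (b j) \<le> M" for j
    proof -
      have "norm (b j) * norm (mixture {0} 0 0) \<le> norm (b j) * norm (block A j)"
        by (intro mult_left_mono norm_block_ge) simp
      then show ?thesis using K[of j] norm_first_mixture_pos by (simp add: M_def norm_s field_simps)
    qed
    have diff: "norm (block A (r j) - mixture A j (start (r j))) \<le> 1/2^j" for j
    proof -
      have "norm (block A (r j) - mixture A j (start (r j))) \<le> (\<Sum>k\<in>{j<..r j}. c k)"
        unfolding block_def by (rule norm_mixture_diff_le[OF r_ge])
      also have "\<dots> \<le> (\<Sum>k\<in>{j<..r j}. 1/2^k)" by (intro sum_mono c_le)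
      also have "\<dots> \<le> 1/2^j" by (rule sum_half_powers_le)
      finally show ?thesis .
    qed
    show "summable (\<lambda>j. s (b j) ((block A \<circ> r) j))"
    proof (rule summable_if_norm_le[OF sm])
      show "(\<lambda>m. M * (2 * (1/2)^m)) \<longlonglongrightarrow> 0"
        by (intro tendsto_mult_right_zero LIMSEQ_power_zero) simp
      fix m n
      have split: "(\<Sum>j=m..<n. s (b j) ((block A \<circ> r) j)) = (\<Sum>j=m..<n. s (b j) (mixture A j (start (r j))))
          + (\<Sum>j=m..<n. s (b j) (block A (r j) - mixture A j (start (r j))))"
        by (simp add: scale_right_diff_distrib sum_subtractf)
      have M_nonneg: "0 \<le> M" using order.trans[OF norm_ge_zero M] .
      have main: "norm (\<Sum>j=m..<n. s (b j) (mixture A j (start (r j)))) \<le> norm (\<Sum>j=m..<n. s (b j) (block A j))"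
        unfolding block_def by (rule norm_mixture_mono[OF _ _ _ _ sep_r' separated_start]) simp_all
      have "norm (s (b j) (block A (r j) - mixture A j (start (r j)))) \<le> M * (1/2^j)" for j
        unfolding norm_s by (rule mult_mono[OF M diff M_nonneg norm_ge_zero])
      then have "norm (\<Sum>j=m..<n. s (b j) (block A (r j) - mixture A j (start (r j)))) \<le> (\<Sum>j=m..<n. M * (1/2^j))"
        by (rule sum_norm_le)
      also have "(\<Sum>j=m..<n. M * (1/2^j)) = M * (\<Sum>j=m..<n. 1/2^j)"
        by (rule sum_distrib_left[symmetric])
      also have "M * (\<Sum>j=m..<n. 1/2^j) \<le> M * (2/2^m)"
        by (rule mult_left_mono[OF sum_half_powers_atLeast_le M_nonneg])
      finally have rest: "norm (\<Sum>j=m..<n. s (b j) (block A (r j) - mixture A j (start (r j)))) \<le> M * (2 * (1/2)^m)"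
        by (simp add: power_one_over)
      show "norm (\<Sum>j=m..<n. s (b j) ((block A \<circ> r) j)) \<le>
          norm (\<Sum>j=m..<n. s (b j) (block A j)) + M * (2 * (1/2)^m)"
        unfolding split by (rule order.trans[OF norm_triangle_ineq add_mono[OF main rest]])
    qed
  qed
qed

end

section \<open>Blocks along different sets of truncations\<close>

lemma witness_block_ge:
  assumes "k \<in> A" "k \<le> t"
  shows "1 \<le> norm (\<Sum>i<L k. s (d k i) (block A (t + i)))"
proof -
  have "1 \<le> c k * norm (\<Sum>i<L k. s (d k i) (copy k (i * N k)))"
    using witness_large[of k] by (simp add: s_copy)
  also have "\<dots> = norm (c k *\<^sub>R (\<Sum>i<L k. s (d k i) (copy k (i * N k))))"
    using c_pos[of k] by simp
  also have "\<dots> = norm (\<Sum>i<L k. s (d k i) (mixture {k} k (i * N k)))"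
    by (simp add: mixture_def s_scaleR scaleR_sum_right)
  also have "\<dots> \<le> norm (\<Sum>i<L k. s (d k i) (mixture A (t + i) (start (t + i))))"
  proof (rule norm_mixture_mono)
    show "separated {..<L k} (\<lambda>i. N k) (\<lambda>i. i * N k)"
      unfolding separated_def by (metis Suc_leI mult_Suc mult_le_mono1 add.commute)
    show "separated {..<L k} (\<lambda>i. N (t + i)) (\<lambda>i. start (t + i))"
      by (simp add: separated_def start_add_N_le)
  qed (use assms in auto)
  finally show ?thesis by (simp add: block_def)
qed

text \<open>The copies are sums over the coordinates \<open>j\<close> of \<open>a j\<close> times a subsequence of \<open>e\<close>, which is
  isometrically equivalent to \<open>e\<close>.\<close>

lemma norm_sum_copies_le:
  "norm (\<Sum>i<l. s (b i) (copy k (start (t + i))))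
    \<le> (\<Sum>j<N k. norm (a j)) * norm (\<Sum>i<l. s (b i) (e i))"
proof -
  have "(\<Sum>i<l. s (b i) (copy k (start (t + i))))
      = (\<Sum>j<N k. s (a j) (\<Sum>i<l. s (b i) (e (start (t + i) + j))))"
    unfolding copy_def scale_sum_right scale_scale by (subst sum.swap) (simp only: mult.commute)
  also have "norm \<dots> \<le> (\<Sum>j<N k. norm (a j) * norm (\<Sum>i<l. s (b i) (e (start (t + i) + j))))"
    by (intro sum_norm_le) (simp add: norm_s)
  also have "\<dots> = (\<Sum>j<N k. norm (a j) * norm (\<Sum>i<l. s (b i) (e i)))"
  proof (intro sum.cong refl arg_cong2[where f = "(*)"] norm_subsequence)
    show "strict_mono_on {..<l} (\<lambda>i. start (t + i) + j)" for j
      using strict_mono_start by (simp add: strict_mono_on_def strict_monoD)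
  qed
  finally show ?thesis by (simp add: sum_distrib_right)
qed

text \<open>As \<open>k \<notin> A\<close>, the truncations that occur come before \<open>k\<close>, where the small norm of the witness
  against \<open>e\<close> helps, or after \<open>k\<close>, where the weights are small.\<close>

lemma witness_block_le:
  assumes "k \<notin> A" "k \<le> t"
  shows "norm (\<Sum>i<L k. s (d k i) (block A (t + i))) \<le> 2/2^k"
proof -
  let ?D = "norm (\<Sum>i<L k. s (d k i) (e i))"
  have "A \<inter> {..k} = A \<inter> {..<k}" using assms(1) by (auto simp: order.order_iff_strict)
  then have "(\<Sum>i<L k. s (d k i) (mixture A k (start (t + i))))
      = (\<Sum>k'\<in>A \<inter> {..<k}. c k' *\<^sub>R (\<Sum>i<L k. s (d k i) (copy k' (start (t + i)))))"
    unfolding mixture_def by (simp add: scale_sum_right s_scaleR scaleR_sum_right) (rule sum.swap)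
  then have "norm (\<Sum>i<L k. s (d k i) (mixture A k (start (t + i))))
      \<le> (\<Sum>k'\<in>A \<inter> {..<k}. norm (c k' *\<^sub>R (\<Sum>i<L k. s (d k i) (copy k' (start (t + i))))))"
    by (simp only: norm_sum)
  also have "\<dots> \<le> (\<Sum>k'\<in>A \<inter> {..<k}. c k' * ((\<Sum>j<N k'. norm (a j)) * ?D))"
    using c_pos norm_sum_copies_le by (intro sum_mono) (simp add: abs_of_pos mult_left_mono)
  also have "\<dots> \<le> (\<Sum>k'<k. c k' * ((\<Sum>j<N k'. norm (a j)) * ?D))"
    using c_pos less_imp_le by (intro sum_mono2) (auto intro!: mult_nonneg_nonneg sum_nonneg)
  also have "\<dots> = (\<Sum>k'<k. c k' * (\<Sum>j<N k'. norm (a j))) * ?D"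
    by (simp add: sum_distrib_right mult.assoc)
  also have "\<dots> \<le> 1/2^k" by (rule witness_small)
  finally have early: "norm (\<Sum>i<L k. s (d k i) (mixture A k (start (t + i)))) \<le> 1/2^k" .
  have late: "norm (\<Sum>i<L k. s (d k i) (block A (t + i) - mixture A k (start (t + i)))) \<le> 1/2^k"
  proof -
    let ?M = "t + L k"
    have "norm (block A (t + i) - mixture A k (start (t + i))) \<le> (\<Sum>k'\<in>{k<..?M}. c k')" if "i < L k" for i
    proof -
      have "norm (block A (t + i) - mixture A k (start (t + i))) \<le> (\<Sum>k'\<in>{k<..t + i}. c k')"
        unfolding block_def using assms(2) by (intro norm_mixture_diff_le) simp
      also have "\<dots> \<le> (\<Sum>k'\<in>{k<..?M}. c k')"
        using that c_pos less_imp_le by (intro sum_mono2) auto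
      finally show ?thesis .
    qed
    then have "norm (\<Sum>i<L k. s (d k i) (block A (t + i) - mixture A k (start (t + i))))
        \<le> (\<Sum>i<L k. norm (d k i) * (\<Sum>k'\<in>{k<..?M}. c k'))"
      by (intro sum_norm_le) (simp add: norm_s mult_left_mono)
    also have "\<dots> = (\<Sum>k'\<in>{k<..?M}. c k' * (\<Sum>i<L k. norm (d k i)))"
      by (simp add: sum_distrib_right[symmetric] mult.commute)
    also have "\<dots> \<le> (\<Sum>k'\<in>{k<..?M}. 1/2^k')"
      using later_weight_small by (intro sum_mono) simp
    also have "\<dots> \<le> 1/2^k" by (rule sum_half_powers_le)
    finally show ?thesis .
  qed
  have split: "(\<Sum>i<L k. s (d k i) (block A (t + i))) = (\<Sum>i<L k. s (d k i) (mixture A k (start (t + i))))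
      + (\<Sum>i<L k. s (d k i) (block A (t + i) - mixture A k (start (t + i))))"
    by (simp add: scale_right_diff_distrib sum_subtractf)
  have "norm (\<Sum>i<L k. s (d k i) (block A (t + i))) \<le> 1/2^k + 1/2^k"
    unfolding split by (rule order.trans[OF norm_triangle_ineq add_mono[OF early late]])
  then show ?thesis by simp
qed

text \<open>A gliding hump: the witnesses with index in \<open>A - B\<close> are placed one after another.  The
  resulting series of blocks along \<open>A\<close> has infinitely many segments of norm at least 1, whereas
  the segments along \<open>B\<close> have norms bounded by a geometric series.\<close>

lemma not_equivalent_blocks:
  assumes "0 \<in> B" and inf: "infinite (A - B)"
  shows "\<not> equivalent_sequences s (block A) (block B)"
proof -
  define \<tau> where "\<tau> k = (\<Sum>i<k. L i)" for k
  have \<tau>_Suc: "\<tau> (Suc k) = \<tau> k + L k" for k by (simp add: \<tau>_def)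
  \<comment> \<open>The bounds for the \<open>k\<close>-th witness hold only against blocks from the \<open>k\<close>-th one on.\<close>
  have \<tau>_ge: "k \<le> \<tau> k" for k
  proof (induction k)
    case (Suc k)
    then show ?case using L_pos[of k] by (simp add: \<tau>_Suc)
  qed simp
  have \<tau>_mono: "\<tau> k \<le> \<tau> k'" if "k \<le> k'" for k k'
    unfolding \<tau>_def by (rule sum_mono2) (use that in auto)
  obtain \<beta> where \<beta>: "\<And>k j. j < L k \<Longrightarrow> \<beta> (\<tau> k + j) = (if k \<in> A - B then d k j else 0)"
    using concatenation_exists[of L "\<lambda>k j. if k \<in> A - B then d k j else 0"] unfolding \<tau>_def by metis
  have stretch: "(\<Sum>i=\<tau> k..<\<tau> (Suc k). s (\<beta> i) (y i))
      = (if k \<in> A - B then \<Sum>i<L k. s (d k i) (y (\<tau> k + i)) else 0)" for k and y :: "nat \<Rightarrow> 'a"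
  proof -
    have "(\<Sum>i=\<tau> k..<\<tau> (Suc k). s (\<beta> i) (y i)) = (\<Sum>j<L k. s (\<beta> (\<tau> k + j)) (y (\<tau> k + j)))"
      by (simp add: sum.atLeastLessThan_shift_0 \<tau>_Suc atLeast0LessThan)
    also have "\<dots> = (\<Sum>j<L k. s (if k \<in> A - B then d k j else 0) (y (\<tau> k + j)))"
      by (rule sum.cong) (simp_all only: \<beta> lessThan_iff)
    finally show ?thesis by (cases "k \<in> A - B") (simp_all only: if_True if_False scale_zero_left sum.neutral_const)
  qed
  have B_small: "norm (\<Sum>i=\<tau> k..<\<tau> (Suc k). s (\<beta> i) (block B i)) \<le> 2/2^k" for k
    unfolding stretch using witness_block_le[OF _ \<tau>_ge[of k], of B] by simp
  interpret B: subset_monotone_sequence s "block B"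
    by (rule subset_monotone_block[OF assms(1)])
  have tail: "norm (\<Sum>i=m..<n. s (\<beta> i) (block B i)) \<le> 4 * (1/2)^K" if "\<tau> K \<le> m" for K m n
  proof -
    let ?K' = "max K n"
    have sub: "{m..<n} \<subseteq> {\<tau> K..<\<tau> ?K'}"
      using that \<tau>_ge[of ?K'] by auto
    have "(\<Sum>i=\<tau> K..<\<tau> K'. s (\<beta> i) (block B i))
        = (\<Sum>k=K..<K'. \<Sum>i=\<tau> k..<\<tau> (Suc k). s (\<beta> i) (block B i))" if "K \<le> K'" for K'
      using that
    proof (induction K' rule: dec_induct)
      case (step K')
      then show ?case
        using sum.atLeastLessThan_concat[of "\<tau> K" "\<tau> K'" "\<tau> (Suc K')" "\<lambda>i. s (\<beta> i) (block B i)"]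
          \<tau>_mono[of K K'] \<tau>_mono[of K' "Suc K'"] by simp
    qed simp
    then have "norm (\<Sum>i=\<tau> K..<\<tau> ?K'. s (\<beta> i) (block B i))
        = norm (\<Sum>k=K..<?K'. \<Sum>i=\<tau> k..<\<tau> (Suc k). s (\<beta> i) (block B i))" by simp
    also have "\<dots> \<le> (\<Sum>k=K..<?K'. 2 * (1/2^k))"
      using B_small by (intro sum_norm_le) simp
    also have "\<dots> \<le> 2 * (2/2^K)"
      unfolding sum_distrib_left[symmetric] by (intro mult_left_mono sum_half_powers_atLeast_le) simp
    finally show ?thesis
      using B.subset_mono[OF finite_atLeastLessThan sub, of \<beta>] by (simp add: power_one_over)
  qed
  have "summable (\<lambda>i. s (\<beta> i) (block B i))"
    unfolding summable_Cauchy
  proof (intro allI impI)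
    fix \<epsilon> :: real assume "\<epsilon> > 0"
    moreover have "(\<lambda>K. 4 * (1/2)^K :: real) \<longlonglongrightarrow> 0"
      by (intro tendsto_mult_right_zero LIMSEQ_power_zero) simp
    ultimately have "\<forall>\<^sub>F K in sequentially. 4 * (1/2)^K < \<epsilon>" by (simp only: order_tendstoD(2))
    then obtain K where "4 * (1/2)^K < \<epsilon>" by (auto simp: eventually_sequentially)
    then have "\<forall>m\<ge>\<tau> K. \<forall>n. norm (\<Sum>i=m..<n. s (\<beta> i) (block B i)) < \<epsilon>"
      using tail order.strict_trans1 by meson
    then show "\<exists>M. \<forall>m\<ge>M. \<forall>n. norm (\<Sum>i=m..<n. s (\<beta> i) (block B i)) < \<epsilon>" by (rule exI)
  qed
  moreover have "\<not> summable (\<lambda>i. s (\<beta> i) (block A i))"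
  proof
    assume "summable (\<lambda>i. s (\<beta> i) (block A i))"
    then obtain M where M: "\<And>m n. m \<ge> M \<Longrightarrow> norm (\<Sum>i=m..<n. s (\<beta> i) (block A i)) < 1"
      unfolding summable_Cauchy by (meson zero_less_one)
    obtain k where k: "k \<ge> M" "k \<in> A - B"
      using inf unfolding infinite_nat_iff_unbounded_le by meson
    have "1 \<le> norm (\<Sum>i=\<tau> k..<\<tau> (Suc k). s (\<beta> i) (block A i))"
      unfolding stretch using k witness_block_ge[OF _ \<tau>_ge[of k], of A] by simp
    then show False using M[of "\<tau> k" "\<tau> (Suc k)"] k \<tau>_ge[of k] by simp
  qed
  ultimately show ?thesis unfolding equivalent_sequences_def by meson
qed

end

text \<open>To a set \<open>C\<close> belongs the set of its (encoded) initial segments.  Different sets share only the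
  initial segments up to the first difference, apart from the number 0, which is added to all of
  them.\<close>

lemma almost_disjoint_family:
  obtains A :: "nat set \<Rightarrow> nat set"
  where "\<And>C. 0 \<in> A C" and "\<And>C D. C \<noteq> D \<Longrightarrow> infinite (A C - A D)"
proof
  define code where "code C n = to_nat (map (\<lambda>i. i \<in> C) [0..<n])" for C n
  have code_eq: "n = m \<and> (\<forall>i<n. i \<in> C \<longleftrightarrow> i \<in> D)" if "code C n = code D m" for C D n m
  proof -
    have eq: "map (\<lambda>i. i \<in> C) [0..<n] = map (\<lambda>i. i \<in> D) [0..<m]"
      using that unfolding code_def by simp
    have "n = m" using arg_cong[OF eq, of length] by (simp only: length_map length_upt diff_zero)
    with eq show ?thesis by simp
  qed
  show "0 \<in> insert 0 (range (code C))" for C by simp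
  show "infinite (insert 0 (range (code C)) - insert 0 (range (code D)))" if CD: "C \<noteq> D" for C D
  proof -
    obtain m where m: "m \<in> C \<longleftrightarrow> m \<notin> D" using CD by blast
    have "inj (code C)" using code_eq by (meson injI)
    then have "infinite (code C ` {m<..} - {0})"
      by (simp add: finite_image_iff inj_on_subset infinite_Ioi)
    moreover have "code C ` {m<..} - {0} \<subseteq> insert 0 (range (code C)) - insert 0 (range (code D))"
    proof
      fix k assume "k \<in> code C ` {m<..} - {0}"
      then obtain n where n: "k = code C n" "m < n" "k \<noteq> 0" by auto
      have "k \<noteq> code D n'" for n' using code_eq[of C n D n'] n m by auto
      then show "k \<in> insert 0 (range (code C)) - insert 0 (range (code D))" using n by auto
    qed
    ultimately show ?thesis using finite_subset by blast
  qed
qed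

context block_tower
begin

lemma continuum_of_block_bases:
  "\<exists>F :: (nat \<Rightarrow> 'a) set. F \<approx> (UNIV :: nat set set)
     \<and> (\<forall>y\<in>F. block_basis s e y \<and> subsymmetric s y)
     \<and> pairwise (\<lambda>y z. \<not> equivalent_sequences s y z) F"
proof -
  obtain A :: "nat set \<Rightarrow> nat set" where zero: "\<And>C. 0 \<in> A C"
    and inf: "\<And>C D. C \<noteq> D \<Longrightarrow> infinite (A C - A D)"
    using almost_disjoint_family by metis
  have noneq: "\<not> equivalent_sequences s (block (A C)) (block (A D))" if "C \<noteq> D" for C D
    using not_equivalent_blocks[OF zero inf[OF that]] .
  have "inj (\<lambda>C. block (A C))"
  proof (rule injI, rule ccontr)
    fix C D assume "block (A C) = block (A D)" "C \<noteq> D"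
    then show False using noneq[of C D] by (simp add: equivalent_sequences_def)
  qed
  then have "range (\<lambda>C. block (A C)) \<approx> (UNIV :: nat set set)"
    by (rule inj_on_image_eqpoll_self)
  moreover have "pairwise (\<lambda>y z. \<not> equivalent_sequences s y z) (range (\<lambda>C. block (A C)))"
    by (rule pairwise_imageI) (rule noneq)
  ultimately show ?thesis
    using block_basis_block[OF zero] subsymmetric_block[OF zero]
    by (intro exI[of _ "range (\<lambda>C. block (A C))"]) simp
qed

end

section \<open>The inductive choice of truncations and witnesses\<close>

context one_subsymmetric_sequence
begin

lemma norm_partial_sum_mono:
  assumes "m \<le> n"
  shows "norm (\<Sum>j<m. s (a j) (e j)) \<le> norm (\<Sum>j<n. s (a j) (e j))"
proof -
  have "(\<Sum>j<m. s (a j) (e j)) = (\<Sum>j<n. (if j < m then 1 else 0) *\<^sub>R s (a j) (e j))"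
    by (rule sum.mono_neutral_cong_left) (use assms in auto)
  then show ?thesis
    using norm_multiplier_le[of "{..<n}" "\<lambda>j. if j < m then 1 else 0" a] by simp
qed

lemma norm_partial_sum_le:
  assumes "(\<lambda>j. s (a j) (e j)) sums x"
  shows "norm (\<Sum>j<m. s (a j) (e j)) \<le> norm x"
proof (rule LIMSEQ_le_const)
  show "(\<lambda>n. norm (\<Sum>j<n. s (a j) (e j))) \<longlonglongrightarrow> norm x"
    using assms unfolding sums_def by (rule tendsto_norm)
  show "\<exists>K. \<forall>n\<ge>K. norm (\<Sum>j<m. s (a j) (e j)) \<le> norm (\<Sum>j<n. s (a j) (e j))"
    by (intro exI[of _ m] allI impI norm_partial_sum_mono)
qed

text \<open>A single number \<open>H\<close> records what has to be remembered from the earlier choices: it exceeds the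
  sum of all \<open>\<Sum>j<N. norm (a j)\<close> and of the \<open>\<ell>\<^sub>1\<close>-norms of all witnesses so far.  The next weight is
  \<open>1/(2^k * H)\<close>, and then a truncation and a witness are taken for which the ratio of the two
  norms exceeds \<open>(2^k * H)^2\<close>: one factor \<open>2^k * H\<close> compensates the weight, the other one makes
  the norm against \<open>e\<close> small enough.\<close>

lemma block_tower_exists:
  assumes trunc: "\<And>m. norm (\<Sum>j<m. s (a j) (e j)) \<le> 1"
    and unbounded: "\<And>M N0. \<exists>N\<ge>N0. \<exists>n b. M * norm (\<Sum>i<n. s (b i) (e i))
      < norm (\<Sum>i<n. \<Sum>j<N. s (b i * a j) (e (i * N + j)))"
  shows "\<exists>N c L d. block_tower s e a N c L d"
proof -
  define g where "g N n b = norm (\<Sum>i<n. \<Sum>j<N. s (b i * a j) (e (i * N + j)))" for N n and b :: "nat \<Rightarrow> 'k"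
  define D where "D n b = norm (\<Sum>i<n. s (b i) (e i))" for n and b :: "nat \<Rightarrow> 'k"
  define good where "good k H N n b \<longleftrightarrow> 1 \<le> H \<and> 0 < N \<and> 0 < n \<and> 1 \<le> 1/(2^k * H) * g N n b \<and> H * D n b \<le> 1/2^k"
    for k :: nat and H :: real and N n :: nat and b :: "nat \<Rightarrow> 'k"
  have step: "\<exists>N n b. N0 \<le> N \<and> good k H N n b" if H: "1 \<le> H" for k H N0
  proof -
    let ?h = "2^k * H"
    have h: "?h > 0" using H by simp
    obtain N n b where N: "N \<ge> max N0 1" and big: "?h^2 * D n b < g N n b"
      using unbounded[of "max N0 1" "?h^2"] by (auto simp: g_def D_def)
    have "0 \<le> ?h^2 * D n b" by (simp add: D_def)
    then have g_pos: "0 < g N n b" using big by linarith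
    then have n: "0 < n" by (cases n) (simp_all add: g_def)
    \<comment> \<open>The witness is scaled so that its weighted norm against the copies is exactly 1.\<close>
    define r where "r = ?h / g N n b"
    have r_pos: "0 < r" using h g_pos by (simp add: r_def)
    define b' where "b' i = of_real r * b i" for i
    have "(\<Sum>i<n. \<Sum>j<N. s (b' i * a j) (e (i * N + j))) = r *\<^sub>R (\<Sum>i<n. \<Sum>j<N. s (b i * a j) (e (i * N + j)))"
      by (simp add: b'_def mult.assoc s_of_real_mult scaleR_sum_right)
    then have g_scaled: "g N n b' = r * g N n b" using r_pos by (simp add: g_def)
    have "(\<Sum>i<n. s (b' i) (e i)) = r *\<^sub>R (\<Sum>i<n. s (b i) (e i))"
      by (simp add: b'_def s_of_real_mult scaleR_sum_right)
    then have D_scaled: "D n b' = r * D n b" using r_pos by (simp add: D_def)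
    have "1 \<le> 1/?h * g N n b'" using g_pos H by (simp add: g_scaled r_def)
    moreover have "H * D n b' \<le> 1/2^k"
    proof -
      have "2^k * (H * D n b') = ?h^2 * D n b / g N n b"
        by (simp add: D_scaled r_def power2_eq_square)
      also have "\<dots> \<le> 1" using big g_pos by simp
      finally show ?thesis by (simp add: field_simps)
    qed
    ultimately have "good k H N n b'" using H N n by (simp add: good_def)
    then show ?thesis using N by (intro exI[of _ N] exI[of _ n] exI[of _ b']) simp
  qed
  define P where "P k x = (case x of (H, N, n, b) \<Rightarrow> good k H N n b)" for k x
  define Q where "Q x y = (case x of (H, N, n, b) \<Rightarrow> case y of (H', N', n', b') \<Rightarrow>
      H + (\<Sum>j<N. norm (a j)) + (\<Sum>i<n. norm (b i)) \<le> H' \<and> N \<le> N')"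
    for x y :: "real \<times> nat \<times> nat \<times> (nat \<Rightarrow> 'k)"
  have "\<exists>f. \<forall>k. P k (f k) \<and> Q (f k) (f (Suc k))"
  proof (rule dependent_nat_choice)
    obtain N n b where "good 0 1 N n b" using step[of 1 0 0] by auto
    then show "\<exists>x. P 0 x" unfolding P_def by (intro exI[of _ "(1, N, n, b)"]) simp
  next
    fix x k assume "P k x"
    obtain H N n b where x: "x = (H, N, n, b)" by (cases x)
    let ?H' = "H + (\<Sum>j<N. norm (a j)) + (\<Sum>i<n. norm (b i))"
    have "1 \<le> H" using \<open>P k x\<close> by (simp add: P_def x good_def)
    moreover have "0 \<le> (\<Sum>j<N. norm (a j))" "0 \<le> (\<Sum>i<n. norm (b i))" by (simp_all add: sum_nonneg)
    ultimately have "1 \<le> ?H'" by linarith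
    then obtain N' n' b' where "N \<le> N'" "good (Suc k) ?H' N' n' b'" using step by metis
    then show "\<exists>y. P (Suc k) y \<and> Q x y"
      unfolding P_def Q_def x by (intro exI[of _ "(?H', N', n', b')"]) simp
  qed
  then obtain f where f: "\<And>k. P k (f k)" "\<And>k. Q (f k) (f (Suc k))" by metis
  define H where "H k = fst (f k)" for k
  define N where "N k = fst (snd (f k))" for k
  define L where "L k = fst (snd (snd (f k)))" for k
  define d where "d k = snd (snd (snd (f k)))" for k
  have good: "good k (H k) (N k) (L k) (d k)" for k
    using f(1)[of k] by (simp add: P_def H_def N_def L_def d_def case_prod_beta)
  have grow: "H k + (\<Sum>j<N k. norm (a j)) + (\<Sum>i<L k. norm (d k i)) \<le> H (Suc k)" "N k \<le> N (Suc k)" for k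
    using f(2)[of k] by (simp_all add: Q_def H_def N_def L_def d_def case_prod_beta)
  have H_ge1: "1 \<le> H k" for k using good by (simp add: good_def)
  have nonneg: "0 \<le> (\<Sum>j<N k. norm (a j))" "0 \<le> (\<Sum>i<L k. norm (d k i))" for k by (simp_all add: sum_nonneg)
  have "H k \<le> H (Suc k)" for k using grow(1)[of k] nonneg[of k] by linarith
  then have H_mono: "H k \<le> H k'" if "k \<le> k'" for k k' using that by (rule lift_Suc_mono_le)
  have H_ge_sum: "(\<Sum>k'<k. \<Sum>j<N k'. norm (a j)) \<le> H k" for k
  proof (induction k)
    case 0
    show ?case using H_ge1[of 0] by simp
  next
    case (Suc k)
    then show ?case using grow(1)[of k] nonneg(2)[of k] by simp
  qed
  define c where "c k = 1/(2^k * H k)" for k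
  have c_pos: "0 < c k" for k using H_ge1[of k] by (simp add: c_def)
  have c_le: "c k \<le> 1/2^k" for k using H_ge1[of k] by (simp add: c_def field_simps)
  have "block_tower s e a N c L d"
  proof
    show "norm (\<Sum>j<m. s (a j) (e j)) \<le> 1" for m by (rule trunc)
    show "mono N" using grow(2) by (simp add: mono_iff_le_Suc)
    show "0 < N k" "0 < L k" for k using good[of k] by (simp_all add: good_def)
    show "0 < c k" "c k \<le> 1/2^k" for k by (rule c_pos, rule c_le)
    show "1 \<le> c k * norm (\<Sum>i<L k. \<Sum>j<N k. s (d k i * a j) (e (i * N k + j)))" for k
      using good[of k] by (simp add: good_def c_def g_def)
    show "(\<Sum>k'<k. c k' * (\<Sum>j<N k'. norm (a j))) * norm (\<Sum>i<L k. s (d k i) (e i)) \<le> 1/2^k" for k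
    proof -
      have "c k' \<le> 1" for k' by (rule order.trans[OF c_le]) simp
      then have "(\<Sum>k'<k. c k' * (\<Sum>j<N k'. norm (a j))) \<le> (\<Sum>k'<k. \<Sum>j<N k'. norm (a j))"
        using c_pos less_imp_le nonneg(1) by (intro sum_mono mult_left_le_one_le) auto
      also have "\<dots> \<le> H k" by (rule H_ge_sum)
      finally have "(\<Sum>k'<k. c k' * (\<Sum>j<N k'. norm (a j))) * D (L k) (d k) \<le> H k * D (L k) (d k)"
        by (intro mult_right_mono) (simp_all add: D_def)
      also have "\<dots> \<le> 1/2^k" using good[of k] by (simp add: good_def)
      finally show ?thesis by (simp add: D_def)
    qed
    show "c k' * (\<Sum>i<L k. norm (d k i)) \<le> 1/2^k'" if "k < k'" for k k'
    proof -
      have "(\<Sum>i<L k. norm (d k i)) \<le> H (Suc k)" using grow(1)[of k] nonneg(1)[of k] H_ge1[of k] by linarith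
      also have "\<dots> \<le> H k'" using that by (intro H_mono) simp
      finally have "c k' * (\<Sum>i<L k. norm (d k i)) \<le> c k' * H k'"
        using c_pos[of k'] by (intro mult_left_mono) simp_all
      also have "\<dots> = 1/2^k'" using H_ge1[of k'] by (simp add: c_def)
      finally show ?thesis .
    qed
  qed
  then show ?thesis by (intro exI)
qed

end

section \<open>Domination and finite sums\<close>

lemma (in normed_scaling_space) sum_atLeastLessThan_eq_truncated:
  fixes m n :: nat
  shows "(\<Sum>j=m..<n. s (b j) (v j)) = (\<Sum>j<n. s (if m \<le> j then b j else 0) (v j))"
  by (rule sum.mono_neutral_cong_left) auto

lemma double_sum_eq_div_mod:
  fixes f :: "nat \<Rightarrow> nat \<Rightarrow> 'c::comm_monoid_add"
  assumes "0 < N"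
  shows "(\<Sum>i<n. \<Sum>j<N. f i j) = (\<Sum>m<n * N. f (m div N) (m mod N))"
proof -
  have row: "(\<Sum>m=i * N..<i * N + N. f (m div N) (m mod N)) = (\<Sum>j<N. f i j)" for i
    using assms by (simp add: sum.atLeastLessThan_shift_0 atLeast0LessThan)
  have "(\<Sum>m<n * N. f (m div N) (m mod N)) = (\<Sum>i<n. \<Sum>m=i * N..<i * N + N. f (m div N) (m mod N))"
    by (rule sum.nat_group[symmetric])
  then show ?thesis by (simp only: row)
qed

lemma omega_sq_less_div_mod:
  assumes "0 < N" "m < m'"
  shows "omega_sq_less (m div N, Suc (m mod N)) (m' div N, Suc (m' mod N))"
proof -
  have "m div N \<le> m' div N" using assms by (simp add: div_le_mono)
  moreover have "m mod N < m' mod N" if "m div N = m' div N"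
    using that assms(2) by (metis div_mult_mod_eq nat_add_left_cancel_less)
  ultimately show ?thesis by (auto simp: omega_sq_less_def)
qed

context one_subsymmetric_sequence
begin

text \<open>This is where the space \<open>X(\<omega>\<^sup>2)\<close> is left: if the operators from \<open>e\<close> to the consecutive copies of
  long truncations of \<open>x\<close> are uniformly bounded, then letting the length tend to infinity gives a
  bounded operator to the infinite copies.  Finitely many truncated copies of
  length \<open>N\<close> occupy an increasing sequence of ordinals, which division with remainder by \<open>N\<close>
  identifies with an initial segment of the natural numbers.\<close>

lemma dominates_omega_copy:
  fixes t :: "'k \<Rightarrow> 'b::banach \<Rightarrow> 'b"
  assumes basis: "schauder_basis_of s e UNIV"
    and realisation: "omega_sq_realisation s e t E"
    and bound: "\<And>N n b. N0 \<le> N \<Longrightarrow>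
      norm (\<Sum>i<n. \<Sum>j<N. s (b i * basis_coeff s e x j) (e (i * N + j))) \<le> M * norm (\<Sum>i<n. s (b i) (e i))"
  shows "dominates s t e (omega_copy s e t E x)"
proof -
  interpret t: normed_scaling_space t
    using realisation by unfold_locales (simp add: omega_sq_realisation_def)
  have E_norm: "norm (\<Sum>i<n. t (b i) (E (\<alpha> i))) = norm (\<Sum>i<n. s (b i) (e i))"
    if "\<And>i k. i < k \<Longrightarrow> omega_sq_less (\<alpha> i) (\<alpha> k)" for n b \<alpha>
    using realisation that by (simp add: omega_sq_realisation_def)
  note coeff_sums = basis_coeff_sums[OF basis]
  define a where "a = basis_coeff s e x"
  define X where "X = omega_copy s e t E x"
  have row: "(\<lambda>j. t (a j) (E (i, Suc j))) sums X i" for i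
  proof -
    have "summable (\<lambda>j. s (a j) (e j))" using coeff_sums[of x] by (simp add: a_def sums_iff)
    then have "summable (\<lambda>j. t (a j) (E (i, Suc j)))"
    proof (rule summable_if_norm_le[OF _ tendsto_const])
      show "norm (\<Sum>j=m..<n. t (a j) (E (i, Suc j))) \<le> norm (\<Sum>j=m..<n. s (a j) (e j)) + 0" for m n
        unfolding sum_atLeastLessThan_eq_truncated t.sum_atLeastLessThan_eq_truncated
        using E_norm[of "\<lambda>j. (i, Suc j)"] by (simp add: omega_sq_less_def)
    qed
    then show ?thesis by (simp add: X_def omega_copy_def a_def summable_sums)
  qed
  have finite_bound: "norm (\<Sum>i<n. t (b i) (X i)) \<le> M * norm (\<Sum>i<n. s (b i) (e i))" for n b
  proof (rule LIMSEQ_le_const2)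
    show "(\<lambda>N. norm (\<Sum>i<n. t (b i) (\<Sum>j<N. t (a j) (E (i, Suc j))))) \<longlonglongrightarrow> norm (\<Sum>i<n. t (b i) (X i))"
      using row unfolding sums_def
      by (intro tendsto_norm tendsto_sum bounded_linear.tendsto[OF t.bounded_linear_s])
    have "norm (\<Sum>i<n. t (b i) (\<Sum>j<N. t (a j) (E (i, Suc j)))) \<le> M * norm (\<Sum>i<n. s (b i) (e i))"
      if "max N0 1 \<le> N" for N
    proof -
      have N: "0 < N" using that by simp
      have "norm (\<Sum>i<n. t (b i) (\<Sum>j<N. t (a j) (E (i, Suc j))))
          = norm (\<Sum>m<n * N. t (b (m div N) * a (m mod N)) (E (m div N, Suc (m mod N))))"
        using double_sum_eq_div_mod[OF N, of "\<lambda>i j. t (b i * a j) (E (i, Suc j))"]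
        by (simp add: t.scale_sum_right)
      also have "\<dots> = norm (\<Sum>m<n * N. s (b (m div N) * a (m mod N)) (e m))"
        by (rule E_norm) (rule omega_sq_less_div_mod[OF N])
      also have "\<dots> = norm (\<Sum>i<n. \<Sum>j<N. s (b i * a j) (e (i * N + j)))"
        using double_sum_eq_div_mod[OF N, of "\<lambda>i j. s (b i * a j) (e (i * N + j))"] by simp
      also have "\<dots> \<le> M * norm (\<Sum>i<n. s (b i) (e i))"
        using bound that by (simp add: a_def)
      finally show ?thesis .
    qed
    then show "\<exists>K. \<forall>N\<ge>K. norm (\<Sum>i<n. t (b i) (\<Sum>j<N. t (a j) (E (i, Suc j)))) \<le> M * norm (\<Sum>i<n. s (b i) (e i))"
      by (intro exI[of _ "max N0 1"]) simp
  qed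
  have summable: "summable (\<lambda>i. t (basis_coeff s e u i) (X i))" for u
  proof -
    have "summable (\<lambda>i. M *\<^sub>R s (basis_coeff s e u i) (e i))"
      using coeff_sums[of u] by (intro summable_scaleR_right) (simp add: sums_iff)
    then show ?thesis
    proof (rule summable_if_norm_le[OF _ tendsto_const])
      fix m n
      have "norm (\<Sum>i=m..<n. t (basis_coeff s e u i) (X i)) \<le> M * norm (\<Sum>i=m..<n. s (basis_coeff s e u i) (e i))"
        unfolding sum_atLeastLessThan_eq_truncated t.sum_atLeastLessThan_eq_truncated by (rule finite_bound)
      also have "\<dots> \<le> \<bar>M\<bar> * norm (\<Sum>i=m..<n. s (basis_coeff s e u i) (e i))"
        by (intro mult_right_mono) simp_all
      finally show "norm (\<Sum>i=m..<n. t (basis_coeff s e u i) (X i)) \<le>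
          norm (\<Sum>i=m..<n. M *\<^sub>R s (basis_coeff s e u i) (e i)) + 0"
        by (simp add: scaleR_sum_right[symmetric])
    qed
  qed
  define T where "T u = (\<Sum>i. t (basis_coeff s e u i) (X i))" for u
  have T_sums: "(\<lambda>i. t (basis_coeff s e u i) (X i)) sums T u" for u
    using summable by (simp add: T_def summable_sums)
  have T_eqI: "T u = z" if "(\<lambda>i. s (b i) (e i)) sums u" "(\<lambda>i. t (b i) (X i)) sums z" for u b z
    using that T_sums[of u] basis_coeff_eqI[OF basic_e that(1)] sums_unique2 by metis
  have T_add: "T (u + v) = T u + T v" for u v
    using sums_add[OF coeff_sums[of u] coeff_sums[of v]] sums_add[OF T_sums[of u] T_sums[of v]]
    by (intro T_eqI[of "\<lambda>i. basis_coeff s e u i + basis_coeff s e v i"])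
      (simp_all add: scale_left_distrib t.scale_left_distrib)
  have T_scale: "T (s k u) = t k (T u)" for k u
    using bounded_linear.sums[OF bounded_linear_s coeff_sums[of u], of k]
      bounded_linear.sums[OF t.bounded_linear_s T_sums[of u], of k]
    by (intro T_eqI[of "\<lambda>i. k * basis_coeff s e u i"]) simp_all
  have T_norm: "norm (T u) \<le> M * norm u" for u
  proof (rule LIMSEQ_le)
    show "(\<lambda>n. norm (\<Sum>i<n. t (basis_coeff s e u i) (X i))) \<longlonglongrightarrow> norm (T u)"
      using T_sums unfolding sums_def by (rule tendsto_norm)
    show "(\<lambda>n. M * norm (\<Sum>i<n. s (basis_coeff s e u i) (e i))) \<longlonglongrightarrow> M * norm u"
      using coeff_sums unfolding sums_def by (intro tendsto_mult_left tendsto_norm)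
  qed (use finite_bound in simp)
  have T_e: "T (e n) = X n" for n
  proof (rule T_eqI)
    have "(\<lambda>i. s (if i = n then 1 else 0) (e i)) = (\<lambda>i. if i = n then e i else 0)" by auto
    then show "(\<lambda>i. s (if i = n then 1 else 0) (e i)) sums e n" using sums_single[of n e] by simp
    have "(\<lambda>i. t (if i = n then 1 else 0) (X i)) = (\<lambda>i. if i = n then X i else 0)" by auto
    then show "(\<lambda>i. t (if i = n then 1 else 0) (X i)) sums X n" using sums_single[of n X] by simp
  qed
  show ?thesis
    unfolding dominates_def X_def[symmetric]
  proof (intro exI[of _ T] conjI ballI allI)
    show "T ` closed_span s (range e) \<subseteq> closed_span t (range X)"
      using t.sums_in_closed_span[OF T_sums] by (rule image_subsetI)
    show "\<exists>K. \<forall>u\<in>closed_span s (range e). norm (T u) \<le> K * norm u"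
      using T_norm by (intro exI[of _ M]) simp
  qed (simp_all only: T_add T_scale T_e)
qed

end

section \<open>Continuum many subsymmetric block bases\<close>

theorem theorem19:
  fixes s :: "'k::{real_normed_field, banach} \<Rightarrow> 'a::banach \<Rightarrow> 'a"
    and e :: "nat \<Rightarrow> 'a"
    and t :: "'k \<Rightarrow> 'b::banach \<Rightarrow> 'b"
    and E :: "nat \<times> nat \<Rightarrow> 'b"
    and x :: 'a
  assumes "normed_scaling s"
    and "schauder_basis_of s e UNIV"
    and "one_subsymmetric s e"
    and "omega_sq_realisation s e t E"
    and "norm x = 1"
    and "\<not> dominates s t e (omega_copy s e t E x)"
  shows "\<exists>F :: (nat \<Rightarrow> 'a) set. F \<approx> (UNIV :: nat set set)
           \<and> (\<forall>y\<in>F. block_basis s e y \<and> subsymmetric s y)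
           \<and> pairwise (\<lambda>y z. \<not> equivalent_sequences s y z) F"
proof -
  interpret one_subsymmetric_sequence s e
    by unfold_locales (use assms(1,3) in simp_all)
  define a where "a = basis_coeff s e x"
  have "(\<lambda>j. s (a j) (e j)) sums x"
    unfolding a_def by (rule basis_coeff_sums[OF assms(2)])
  then have truncations: "norm (\<Sum>j<m. s (a j) (e j)) \<le> 1" for m
    using norm_partial_sum_le assms(5) by metis
  have unbounded: "\<exists>N\<ge>N0. \<exists>n b. M * norm (\<Sum>i<n. s (b i) (e i))
      < norm (\<Sum>i<n. \<Sum>j<N. s (b i * a j) (e (i * N + j)))" for M N0
  proof (rule ccontr)
    assume "\<not> ?thesis"
    then have "norm (\<Sum>i<n. \<Sum>j<N. s (b i * a j) (e (i * N + j))) \<le> M * norm (\<Sum>i<n. s (b i) (e i))"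
      if "N0 \<le> N" for N n b
      using that by (simp add: not_less)
    then have "dominates s t e (omega_copy s e t E x)"
      unfolding a_def by (rule dominates_omega_copy[OF assms(2,4)])
    with assms(6) show False by simp
  qed
  obtain N c L d where tower: "block_tower s e a N c L d"
    using block_tower_exists[OF truncations unbounded] by (elim exE)
  show ?thesis by (rule block_tower.continuum_of_block_bases[OF tower])
qed

end
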